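(* Let $0<p<1$, and let $A=\operatorname{diag}(J_1,\dots,J_l)$ be an $n\times n$ matrix, where $J_j$ is the $n_j\times n_j$ upper triangular Jordan block with eigenvalue $\lambda_j\neq0$, with $|\arg\lambda_j|>p\pi/2$ for $j=1,\dots,s$ and $|\arg\lambda_j|<p\pi/2$ for $j=s+1,\dots,l$. Let $B$, $\widetilde{B}$, $C$ and the projection $\pi_u$ be as defined in the context. Let $N>0$. Then there exist constants $K_3$ and $K_5$, depending on $N$ and on $A,p$ but not on $t$ or $g$, such that for every bounded continuous $g:[0,\infty)\to\mathbb R^n$ and every $t>N$: 1. $$\left\|\int_0^\infty \frac p\tau\,C(t)\,\widetilde{B}(-\tau)\,\pi_u g(\tau)\,d\tau\right\|\le K_3\,\|g\|_\infty;$$ 2. $$\left\|\int_0^t(t-\tau)^{p-1}E_{p,p}\big((t-\tau)^pA\big)\,\pi_u g(\tau)\,d\tau+\int_0^\infty\frac p\tau\,B(t)\,\widetilde{B}(-\tau)\,\pi_u g(\tau)\,d\tau\right\|\le K_5\,\|g\|_\infty .$$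
   Context: The Mittag-Leffler functions are $E_{p,\beta}(z)=\sum_{k\ge0}\frac{z^k}{\Gamma(pk+\beta)}$ and $E_p=E_{p,1}$, applied to square matrices via the power series. Arguments are taken in $(-\pi,\pi]$ and $\lambda^{1/p}$ denotes the principal branch. $\|g\|_\infty=\sup_{t\ge0}\|g(t)\|$. For $t\in\mathbb R$, $B(t)=\operatorname{diag}(B_1(t),\dots,B_l(t))$ and $\widetilde{B}(t)=\operatorname{diag}(\widetilde{B_1}(t),\dots,\widetilde{B_l}(t))$ with $n_j\times n_j$ blocks. For $j=1,\dots,s$, $B_j(t)=\widetilde{B_j}(t)=0$. For $j=s+1,\dots,l$, $B_j(t)$ and $\widetilde{B_j}(t)$ are the upper triangular Toeplitz matrices with first rows $(\Psi_0(t,\lambda_j),\dots,\Psi_{n_j-1}(t,\lambda_j))$ and $(\widetilde{\Psi}_0(t,\lambda_j),\dots,\widetilde{\Psi}_{n_j-1}(t,\lambda_j))$ respectively, where $$\Psi_m(t,\lambda_j)=\frac1{m!}\left.\frac{\partial^m}{\partial\lambda^m}\left(\frac1p\exp(t\lambda^{1/p})\right)\right|_{\lambda=\lambda_j},\qquad \widetilde{\Psi}_m(t,\lambda_j)=\frac1{m!}\left.\frac{\partial^{m+1}}{\partial\lambda^{m+1}}\exp(t\lambda^{1/p})\right|_{\lambda=\lambda_j}.$$ An upper triangular Toeplitz matrix with first row $(a_0,\dots,a_{n-1})$ has $(i,k)$ entry $a_{k-i}$ for $k\ge i$ and $0$ otherwise. For $t>0$, $C(t)$ is defined by $E_p(t^pA)=B(t)+C(t)$.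 The unstable projection $\pi_u$ is the projection onto the coordinates belonging to the blocks $J_{s+1},\dots,J_l$, i.e. it sets to zero the coordinates belonging to $J_1,\dots,J_s$. If some $\lambda_j$ are non-real, $\mathbb R^n$ is regarded as a subset of $\mathbb C^n$. *)

theory Defs
  imports
    "HOL-Analysis.Analysis"
    "Jordan_Normal_Form.Jordan_Normal_Form"
begin

text \<open>
  Blocks are handled with the explicitly sized matrices of the Jordan normal form library, whose
  block lists contain pairs (size, eigenvalue). Analysis takes place in the finite Cartesian
  spaces over an index type \<open>'n\<close>; \<open>ix\<close> is a numbering of \<open>'n\<close> by \<open>0, \<dots>, CARD('n) - 1\<close>.
\<close>

definition to_cart :: "('n::finite \<Rightarrow> nat) \<Rightarrow> complex mat \<Rightarrow> complex ^ 'n ^ 'n" where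
  "to_cart ix M = (\<chi> i k. M $$ (ix i, ix k))"

definition cvec :: "real ^ 'n \<Rightarrow> complex ^ 'n::finite" where
  "cvec v = (\<chi> i. complex_of_real (v $ i))"

definition matpow :: "complex ^ 'n ^ 'n \<Rightarrow> nat \<Rightarrow> complex ^ 'n ^ 'n::finite" where
  "matpow M k = (((**) M) ^^ k) (Finite_Cartesian_Product.mat 1)"

definition mittag_leffler_mat :: "real \<Rightarrow> real \<Rightarrow> complex ^ 'n ^ 'n \<Rightarrow> complex ^ 'n ^ 'n::finite" where
  "mittag_leffler_mat p \<beta> M = (\<Sum>k. (1 / Gamma (p * real k + \<beta>)) *\<^sub>R matpow M k)"

definition toeplitz :: "nat \<Rightarrow> (nat \<Rightarrow> complex) \<Rightarrow> complex mat" where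
  "toeplitz n a = Matrix.mat n n (\<lambda>(i, k). if i \<le> k then a (k - i) else 0)"

definition Psi :: "real \<Rightarrow> real \<Rightarrow> complex \<Rightarrow> nat \<Rightarrow> complex" where
  "Psi p t z m =
     1 / fact m * (deriv ^^ m) (\<lambda>w. 1 / of_real p * exp (of_real t * w powr of_real (1 / p))) z"

definition Psi_tilde :: "real \<Rightarrow> real \<Rightarrow> complex \<Rightarrow> nat \<Rightarrow> complex" where
  "Psi_tilde p t z m =
     1 / fact m * (deriv ^^ Suc m) (\<lambda>w. exp (of_real t * w powr of_real (1 / p))) z"

text \<open>
  In the following, \<open>ss\<close> lists the blocks with \<open>\<bar>arg \<lambda>\<bar> > p \<pi> / 2\<close> and \<open>us\<close> those with
  \<open>\<bar>arg \<lambda>\<bar> < p \<pi> / 2\<close>.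
\<close>

definition A_mat ::
  "('n::finite \<Rightarrow> nat) \<Rightarrow> (nat \<times> complex) list \<Rightarrow> (nat \<times> complex) list \<Rightarrow> complex ^ 'n ^ 'n" where
  "A_mat ix ss us = to_cart ix (jordan_matrix (ss @ us))"

definition unstable_blocks ::
  "('n::finite \<Rightarrow> nat) \<Rightarrow> (nat \<times> complex) list \<Rightarrow> (nat \<times> complex) list \<Rightarrow>
    (nat \<Rightarrow> complex \<Rightarrow> complex mat) \<Rightarrow> complex ^ 'n ^ 'n" where
  "unstable_blocks ix ss us f =
     to_cart ix (diag_block_mat (map (\<lambda>(n, _). 0\<^sub>m n n) ss @ map (\<lambda>(n, z). f n z) us))"

definition B_mat ::
  "('n::finite \<Rightarrow> nat) \<Rightarrow> real \<Rightarrow> (nat \<times> complex) list \<Rightarrow> (nat \<times> complex) list \<Rightarrow>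
    real \<Rightarrow> complex ^ 'n ^ 'n" where
  "B_mat ix p ss us t = unstable_blocks ix ss us (\<lambda>n z. toeplitz n (Psi p t z))"

definition B_tilde ::
  "('n::finite \<Rightarrow> nat) \<Rightarrow> real \<Rightarrow> (nat \<times> complex) list \<Rightarrow> (nat \<times> complex) list \<Rightarrow>
    real \<Rightarrow> complex ^ 'n ^ 'n" where
  "B_tilde ix p ss us t = unstable_blocks ix ss us (\<lambda>n z. toeplitz n (Psi_tilde p t z))"

definition C_mat ::
  "('n::finite \<Rightarrow> nat) \<Rightarrow> real \<Rightarrow> (nat \<times> complex) list \<Rightarrow> (nat \<times> complex) list \<Rightarrow>
    real \<Rightarrow> complex ^ 'n ^ 'n" where
  "C_mat ix p ss us t =
     mittag_leffler_mat p 1 ((t powr p) *\<^sub>R A_mat ix ss us) - B_mat ix p ss us t"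

definition pi_u ::
  "('n::finite \<Rightarrow> nat) \<Rightarrow> (nat \<times> complex) list \<Rightarrow> (nat \<times> complex) list \<Rightarrow>
    complex ^ 'n \<Rightarrow> complex ^ 'n" where
  "pi_u ix ss us v = unstable_blocks ix ss us (\<lambda>n _. 1\<^sub>m n) *v v"

definition sup_norm :: "(real \<Rightarrow> real ^ 'n::finite) \<Rightarrow> real" where
  "sup_norm g = (SUP t\<in>{0..}. norm (g t))"

end

theory Submission
  imports Defs "HOL-Complex_Analysis.Complex_Analysis" "HOL-Real_Asymp.Real_Asymp"
begin

text \<open>
  The proof separates the matrices from the analysis. If \<open>f\<close> is holomorphic near an eigenvalue
  \<open>z\<close>, the upper triangular Toeplitz matrix of the Taylor coefficients of \<open>f\<close> at \<open>z\<close> is \<open>f\<close> of the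
  Jordan block, and \<open>f \<mapsto> f(J)\<close> is multiplicative. On the unstable blocks all the matrices in the
  statement arise in this way from a scalar function, their symbol, and by Cauchy's estimates the
  norm of such a matrix is at most a constant times the supremum of the symbol over small closed
  disks around the eigenvalues (\<open>norm_unstable_fun_le\<close>). So all derivatives in \<open>\<lambda>\<close> disappear, and
  it suffices to bound scalar symbols uniformly for \<open>w\<close> in a compact part of the sector
  \<open>\<bar>Arg w\<bar> < p \<pi> / 2\<close>. The same device yields measurability in \<open>\<tau>\<close>, derivatives being limits of
  difference quotients.

  Write \<open>\<rho>(w) = w\<^bsup>1/p\<^esup>\<close> (\<open>rate\<close>), which has positive real part on the sector, and
  \<open>D(s, w) = E\<^sub>p(s\<^bsup>p\<^esup> w) - exp (s \<rho>(w)) / p\<close> (\<open>defect\<close>). The symbol of the first integrand is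
  \<open>- p D(t, w) \<rho>'(w) exp (- \<tau> \<rho>(w))\<close>; since \<open>D\<close> is bounded, it decays exponentially in \<open>\<tau>\<close>. In the
  second part the two integrands have the symbols \<open>s\<^bsup>p-1\<^esup> E\<^bsub>p,p\<^esub>(s\<^bsup>p\<^esup> w)\<close> and
  \<open>- \<rho>'(w) exp (s \<rho>(w))\<close> with \<open>s = t - \<tau>\<close>. Each of them may grow with \<open>s\<close>, but for \<open>s > 0\<close> their sum is
  \<open>(p / s) \<partial>D/\<partial>w\<close>, which is \<open>O(s\<^bsup>p-1\<^esup>)\<close> for small \<open>s\<close> and \<open>O(s\<^bsup>-1-p\<^esup>)\<close> for large \<open>s\<close>; for \<open>s < 0\<close>
  only the second symbol is present and decays exponentially. Hence the sum of the integrands is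
  dominated by an integrable function of \<open>t - \<tau>\<close>, whose integral does not depend on \<open>t\<close>.

  What remains is that \<open>E\<^sub>p(z) - exp (z\<^bsup>1/p\<^esup>) / p = O(1/\<bar>z\<bar>)\<close> in the closed sector
  (\<open>ml_asymptotics\<close>). In the variable \<open>q = e\<^bsup>u\<^esup>\<close> the loop contours around the negative axis of
  Hankel's formula turn into polygons in the strip \<open>\<bar>Im u\<bar> \<le> \<pi>\<close>, without a branch
  cut: \<open>1 / \<Gamma>(1 + y)\<close> is the limit, as \<open>b \<rightarrow> \<infinity>\<close>, of the mean of \<open>exp (e\<^bsup>u\<^esup> - y u)\<close> over the segment
  \<open>Re u = b\<close>, \<open>\<bar>Im u\<bar> \<le> \<pi>\<close>, with an error that allows summation over \<open>y = p k\<close>. So \<open>E\<^sub>p(z)\<close> is the limit of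
  the means of \<open>exp (e\<^bsup>u\<^esup>) e\<^bsup>pu\<^esup> / (e\<^bsup>pu\<^esup> - z)\<close>. Moving the segment to \<open>Re u = 0\<close> crosses the
  pole \<open>u = Ln z / p\<close>, whose residue is \<open>exp (z\<^bsup>1/p\<^esup>) / p\<close>, and what is left is \<open>O(1/\<bar>z\<bar>)\<close>.
\<close>

section \<open>Contour integrals around rectangles in a strip\<close>

text \<open>
  This is \<open>1 / (2 \<pi> \<i>)\<close> times the integral over the segment from \<open>b - \<i> \<pi>\<close> to \<open>b + \<i> \<pi>\<close>, hence the mean
  value of \<open>f\<close> there. Under \<open>q = exp u\<close> the segment becomes the circle of radius \<open>exp b\<close>, cut at the
  negative axis.
\<close>
definition arc_mean :: "real \<Rightarrow> (complex \<Rightarrow> complex) \<Rightarrow> complex" where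
  "arc_mean b f =
     contour_integral (linepath (Complex b (- pi)) (Complex b pi)) f / (2 * of_real pi * \<i>)"

lemma contour_integral_linepath_same_Im:
  assumes "a < b"
  shows "contour_integral (linepath (Complex a c) (Complex b c)) f
    = integral {a..b} (\<lambda>x. f (Complex x c))"
proof -
  have "contour_integral (linepath (Complex a c) (Complex b c)) f =
      contour_integral (linepath (of_real a) (of_real b)) (\<lambda>u. f (u + \<i> * of_real c))"
    unfolding contour_integral_integral
    by (simp add: linepath_def Complex_eq scaleR_conv_of_real algebra_simps)
  also have "\<dots> = integral {a..b} (\<lambda>x. f (Complex x c))"
    using assms by (subst contour_integral_linepath_Reals_eq) (auto simp: Complex_eq)
  finally show ?thesis .
qed

lemma closed_segment_Complex_Im:
  "a \<le> b \<Longrightarrow> closed_segment (Complex a c) (Complex b c) = {z. Im z = c \<and> Re z \<in> {a..b}}"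
  using closed_segment_same_Im[of "Complex a c" "Complex b c"] closed_segment_eq_real_ivl[of a b]
  by auto

lemma closed_segment_Complex_Re:
  "a \<le> b \<Longrightarrow> closed_segment (Complex c a) (Complex c b) = {z. Re z = c \<and> Im z \<in> {a..b}}"
  using closed_segment_same_Re[of "Complex c a" "Complex c b"] closed_segment_eq_real_ivl[of a b]
  by auto

text \<open>
  The horizontal sides of a rectangle of height \<open>2 \<pi>\<close> correspond to the two banks of the negative axis,
  so only the jump of \<open>f\<close> across the axis enters.
\<close>
lemma contour_integral_strip_rectpath:
  assumes ab: "a < b"
    and cont: "continuous_on (path_image (rectpath (Complex a (- pi)) (Complex b pi))) f"
  shows "contour_integral (rectpath (Complex a (- pi)) (Complex b pi)) f =
    2 * of_real pi * \<i> * (arc_mean b f - arc_mean a f)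
      - integral {a..b} (\<lambda>x. f (Complex x pi) - f (Complex x (- pi)))"
proof -
  let ?c = "- pi" and ?d = pi
  let ?l1 = "linepath (Complex a ?c) (Complex b ?c)"
  let ?l2 = "linepath (Complex b ?c) (Complex b ?d)"
  let ?l3 = "linepath (Complex b ?d) (Complex a ?d)"
  let ?l4 = "linepath (Complex a ?d) (Complex a ?c)"
  let ?P = "path_image (rectpath (Complex a ?c) (Complex b ?d))"
  have P: "?P = {z. Re z \<in> {a, b} \<and> Im z \<in> {?c..?d}} \<union> {z. Im z \<in> {?c, ?d} \<and> Re z \<in> {a..b}}"
    using ab by (subst path_image_rectpath) auto
  have sub: "closed_segment (Complex a ?c) (Complex b ?c) \<subseteq> ?P"
    "closed_segment (Complex b ?c) (Complex b ?d) \<subseteq> ?P"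
    "closed_segment (Complex b ?d) (Complex a ?d) \<subseteq> ?P"
    "closed_segment (Complex a ?d) (Complex a ?c) \<subseteq> ?P"
    unfolding P using ab closed_segment_Complex_Im[of a b] closed_segment_Complex_Re[of ?c ?d]
    by (auto simp: closed_segment_commute[of "Complex b ?d"] closed_segment_commute[of "Complex a ?d"])
  have int: "f contour_integrable_on ?l1" "f contour_integrable_on ?l2"
    "f contour_integrable_on ?l3" "f contour_integrable_on ?l4"
    by (intro contour_integrable_continuous_linepath continuous_on_subset[OF cont] sub)+
  have eq: "contour_integral (rectpath (Complex a ?c) (Complex b ?d)) f =
     contour_integral ?l1 f + contour_integral ?l2 f + contour_integral ?l3 f + contour_integral ?l4 f"
    unfolding rectpath_def Let_def using int
    by (simp add: contour_integrable_joinI valid_path_join valid_path_linepath)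
  have rev: "contour_integral ?l3 f = - contour_integral (linepath (Complex a ?d) (Complex b ?d)) f"
     "contour_integral ?l4 f = - contour_integral (linepath (Complex a ?c) (Complex a ?d)) f"
    using sub(3,4) by (auto intro!: contour_integral_reverse_linepath continuous_on_subset[OF cont]
        simp: closed_segment_commute)
  have cc: "continuous_on {a..b} (\<lambda>x. f (Complex x c))" if "c \<in> {?c, ?d}" for c
    using that unfolding P Complex_eq
    by (intro continuous_on_compose2[OF cont[unfolded P]] continuous_intros) auto
  have "integral {a..b} (\<lambda>x. f (Complex x pi) - f (Complex x (- pi))) =
    integral {a..b} (\<lambda>x. f (Complex x pi)) - integral {a..b} (\<lambda>x. f (Complex x (- pi)))"
    by (intro integral_diff integrable_continuous_real cc) auto
  then show ?thesis
    unfolding eq rev arc_mean_def contour_integral_linepath_same_Im[OF ab]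
    by (simp add: right_diff_distrib)
qed

lemma arc_mean_bound:
  assumes "continuous_on {z. Re z = b} f" "\<And>z. Re z = b \<Longrightarrow> \<bar>Im z\<bar> \<le> pi \<Longrightarrow> norm (f z) \<le> M"
  shows "norm (arc_mean b f) \<le> M"
proof -
  have seg: "closed_segment (Complex b (- pi)) (Complex b pi) = {z. Re z = b \<and> Im z \<in> {- pi..pi}}"
    by (rule closed_segment_Complex_Re) simp
  have M: "M \<ge> 0" using assms(2)[of "of_real b"] norm_ge_zero[of "f (of_real b)"] by (simp del: norm_ge_zero)
  have "norm (contour_integral (linepath (Complex b (- pi)) (Complex b pi)) f)
      \<le> M * norm (Complex b pi - Complex b (- pi))"
    using M assms by (intro contour_integral_bound_linepath contour_integrable_continuous_linepath)
      (auto simp: seg intro: continuous_on_subset)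
  also have "Complex b pi - Complex b (- pi) = 2 * of_real pi * \<i>" by (simp add: complex_eq_iff)
  finally show ?thesis by (simp add: arc_mean_def norm_divide norm_mult field_simps)
qed

lemma arc_mean_diff_entire:
  assumes "a < b" "f holomorphic_on UNIV"
  shows "arc_mean b f - arc_mean a f =
    integral {a..b} (\<lambda>x. f (Complex x pi) - f (Complex x (- pi))) / (2 * of_real pi * \<i>)"
proof -
  have "contour_integral (rectpath (Complex a (- pi)) (Complex b pi)) f = 0"
    using assms by (intro contour_integral_unique Cauchy_theorem_convex_simple[of f UNIV]) auto
  then show ?thesis
    using contour_integral_strip_rectpath[of a b f] assms
      holomorphic_on_imp_continuous_on[OF assms(2)] continuous_on_subset[of UNIV f]
    by (auto simp: field_simps)
qed

section \<open>A contour formula for the reciprocal Gamma function\<close>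

text \<open>
  The integrand \<open>exp q \<cdot> q\<^bsup>-y-1\<^esup> dq\<close> of Hankel's formula for \<open>1 / \<Gamma>(1 + y)\<close> in the variable \<open>q = exp u\<close>,
  where it is entire.
\<close>
definition hankel_kernel :: "real \<Rightarrow> complex \<Rightarrow> complex" where
  "hankel_kernel y u = exp (exp u - of_real y * u)"

lemma holomorphic_hankel_kernel: "hankel_kernel y holomorphic_on A"
  unfolding hankel_kernel_def by (intro holomorphic_intros)

lemma continuous_hankel_kernel: "continuous_on A (hankel_kernel y)"
  by (intro holomorphic_on_imp_continuous_on holomorphic_hankel_kernel)

lemma exp_Complex_pi: "exp (Complex x pi) = - of_real (exp x)" "exp (Complex x (- pi)) = - of_real (exp x)"
  by (auto simp: complex_eq_iff Re_exp Im_exp)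

lemma hankel_kernel_edge:
  "hankel_kernel y (Complex x pi) = of_real (exp (- exp x - y * x)) * cis (- (y * pi))"
  "hankel_kernel y (Complex x (- pi)) = of_real (exp (- exp x - y * x)) * cis (y * pi)"
proof -
  have "hankel_kernel y (Complex x pi) = exp (of_real (- exp x - y * x) + \<i> * of_real (- (y * pi)))"
    unfolding hankel_kernel_def exp_Complex_pi by (simp add: Complex_eq algebra_simps)
  then show "hankel_kernel y (Complex x pi) = of_real (exp (- exp x - y * x)) * cis (- (y * pi))"
    unfolding exp_add cis_conv_exp exp_of_real .
  have "hankel_kernel y (Complex x (- pi)) = exp (of_real (- exp x - y * x) + \<i> * of_real (y * pi))"
    unfolding hankel_kernel_def exp_Complex_pi by (simp add: Complex_eq algebra_simps)
  then show "hankel_kernel y (Complex x (- pi)) = of_real (exp (- exp x - y * x)) * cis (y * pi)"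
    unfolding exp_add cis_conv_exp exp_of_real .
qed

lemma hankel_kernel_jump:
  "hankel_kernel y (Complex x pi) - hankel_kernel y (Complex x (- pi)) =
    of_real (exp (- exp x - y * x)) * (- 2 * \<i> * of_real (sin (pi * y)))"
  unfolding hankel_kernel_edge by (simp add: complex_eq_iff algebra_simps)

lemma arc_mean_hankel_diff:
  assumes "a < b"
  shows "arc_mean b (hankel_kernel y) - arc_mean a (hankel_kernel y) =
    of_real (- sin (pi * y) / pi * integral {a..b} (\<lambda>x. exp (- exp x - y * x)))"
proof -
  have "integral {a..b} (\<lambda>x. complex_of_real (exp (- exp x - y * x)) * (- 2 * \<i> * of_real (sin (pi * y))))
    = integral {a..b} (\<lambda>x. complex_of_real (exp (- exp x - y * x))) * (- 2 * \<i> * of_real (sin (pi * y)))"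
    by (rule integral_mult_left)
  also have "integral {a..b} (\<lambda>x. complex_of_real (exp (- exp x - y * x))) =
    of_real (integral {a..b} (\<lambda>x. exp (- exp x - y * x)))"
    by (intro integral_unique has_integral_of_real integrable_integral integrable_continuous_real
        continuous_intros)
  finally show ?thesis
    unfolding arc_mean_diff_entire[OF assms holomorphic_hankel_kernel] hankel_kernel_jump
    by (simp add: field_simps)
qed

text \<open>
  Integration by parts: \<open>hankel_kernel (y - 1) - y hankel_kernel y\<close> is the derivative of
  \<open>hankel_kernel y\<close>. As \<open>b \<rightarrow> \<infinity>\<close> the boundary term vanishes and the recurrence of \<open>1 / \<Gamma>\<close> appears.
\<close>
lemma arc_mean_hankel_recurrence:
  "arc_mean b (hankel_kernel (y - 1)) - of_real y * arc_mean b (hankel_kernel y) =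
    - of_real (exp (- exp b - y * b) * sin (pi * y) / pi)"
proof -
  let ?l = "linepath (Complex b (- pi)) (Complex b pi)"
  have int: "hankel_kernel y contour_integrable_on ?l" for y
    by (intro contour_integrable_continuous_linepath continuous_hankel_kernel)
  have "((\<lambda>u. hankel_kernel (y - 1) u - of_real y * hankel_kernel y u)
     has_contour_integral (hankel_kernel y (pathfinish ?l) - hankel_kernel y (pathstart ?l))) ?l"
  proof (rule contour_integral_primitive[where S = UNIV])
    fix u
    show "(hankel_kernel y has_field_derivative
      hankel_kernel (y - 1) u - of_real y * hankel_kernel y u) (at u within UNIV)"
      unfolding hankel_kernel_def
      by (auto intro!: derivative_eq_intros simp: algebra_simps exp_diff exp_add exp_minus field_simps)
  qed auto
  then have "contour_integral ?l (\<lambda>u. hankel_kernel (y - 1) u - of_real y * hankel_kernel y u)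
     = of_real (exp (- exp b - y * b)) * (- 2 * \<i> * of_real (sin (pi * y)))"
    using hankel_kernel_jump[of y b] by (simp add: contour_integral_unique)
  moreover have "contour_integral ?l (\<lambda>u. hankel_kernel (y - 1) u - of_real y * hankel_kernel y u)
     = contour_integral ?l (hankel_kernel (y - 1)) - of_real y * contour_integral ?l (hankel_kernel y)"
    using int by (simp add: contour_integral_diff contour_integral_lmul contour_integrable_lmul)
  ultimately have "contour_integral ?l (hankel_kernel (y - 1)) - of_real y * contour_integral ?l (hankel_kernel y)
     = of_real (exp (- exp b - y * b)) * (- 2 * \<i> * of_real (sin (pi * y)))"
    by simp
  moreover have "arc_mean b (hankel_kernel (y - 1)) - of_real y * arc_mean b (hankel_kernel y) =
    (contour_integral ?l (hankel_kernel (y - 1)) - of_real y * contour_integral ?l (hankel_kernel y))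
      / (2 * of_real pi * \<i>)"
    unfolding arc_mean_def by (simp add: diff_divide_distrib)
  ultimately show ?thesis
    by (simp only:) (simp add: field_simps)
qed

lemma norm_hankel_kernel_le: "norm (hankel_kernel y u) \<le> exp (exp (Re u) - y * Re u)"
proof -
  have "Re (exp u) \<le> exp (Re u)" by (simp add: Re_exp)
  then show ?thesis by (simp add: hankel_kernel_def norm_exp_eq_Re)
qed

lemma norm_arc_mean_hankel_le: "norm (arc_mean b (hankel_kernel y)) \<le> exp (exp b - y * b)"
  using norm_hankel_kernel_le
  by (intro arc_mean_bound continuous_hankel_kernel) (metis order_refl)+

lemma integral_exp_substitution:
  fixes a b y :: real
  assumes "a < b"
  shows "integral {a..b} (\<lambda>x. exp (- exp x - y * x)) =
    integral {exp a..exp b} (\<lambda>r. r powr (- y - 1) / exp r)"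
proof -
  have "((\<lambda>x. exp x *\<^sub>R (exp x powr (- y - 1) / exp (exp x))) has_integral
      integral {exp a..exp b} (\<lambda>r. r powr (- y - 1) / exp r)) {a..b}"
  proof (rule has_integral_substitution[where c = "exp a" and d = "exp b"])
    show "continuous_on {exp a..exp b} (\<lambda>r. r powr (- y - 1) / exp r)"
      by (intro continuous_intros) (auto simp: less_le_trans[OF exp_gt_zero])
  qed (use assms in \<open>auto intro!: derivative_eq_intros\<close>)
  moreover have "exp x *\<^sub>R (exp x powr (- y - 1) / exp (exp x)) = exp (- exp x - y * x)" for x :: real
    by (simp add: powr_def exp_diff exp_add exp_minus field_simps)
  ultimately show ?thesis
    using integral_unique by (metis (no_types, lifting) ext)
qed

text \<open>
  For \<open>-1 < y < 0\<close> the left side of the rectangle can be moved to \<open>-\<infinity>\<close>, where the mean vanishes, so the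
  mean over the right side is the integral of the jump. This tends to \<open>- (sin (\<pi> y) / \<pi>) \<Gamma>(- y)\<close>, which
  is \<open>1 / \<Gamma>(1 + y)\<close> by the reflection formula.
\<close>
lemma arc_mean_hankel_tendsto_base:
  assumes y: "-1 < y" "y < 0"
  shows "((\<lambda>b. arc_mean b (hankel_kernel y)) \<longlongrightarrow> of_real (rGamma (1 + y))) at_top"
proof -
  let ?h = "\<lambda>r. r powr (- y - 1) / exp r"
  have G: "(?h has_integral Gamma (- y)) {0..}"
    using Gamma_integral_real[of "- y"] y by simp
  have int: "set_integrable lebesgue {0..} ?h"
    using G by (intro nonnegative_absolutely_integrable_1) (auto simp: has_integral_iff)
  have "((\<lambda>b. LINT r|lebesgue. indicator {exp (- b)..exp b} r *\<^sub>R ?h r) \<longlongrightarrow>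
     (LINT r|lebesgue. indicator {0..} r *\<^sub>R ?h r)) at_top"
  proof (rule integral_dominated_convergence_at_top)
    show "integrable lebesgue (\<lambda>r. indicator {0..} r *\<^sub>R ?h r)"
      using int by (simp add: set_integrable_def)
    show "\<forall>\<^sub>F b in at_top. AE r in lebesgue. norm (indicator {exp (- b)..exp b} r *\<^sub>R ?h r) \<le> indicator {0..} r *\<^sub>R ?h r"
      by (intro always_eventually allI AE_I2)
         (auto simp: indicator_def dest: order_trans[OF less_imp_le[OF exp_gt_zero]])
    have lim: "((\<lambda>b. indicator {exp (- b)..exp b} r *\<^sub>R ?h r) \<longlongrightarrow> indicator {0..} r *\<^sub>R ?h r) at_top" for r
    proof (cases "r > 0")
      case True
      have "\<forall>\<^sub>F b in at_top. indicator {0..} r *\<^sub>R ?h r = indicator {exp (- b)..exp b} r *\<^sub>R ?h r"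
        using eventually_ge_at_top[of "\<bar>ln r\<bar>"]
      proof eventually_elim
        case (elim b)
        then have "exp (- b) \<le> exp (ln r)" "exp (ln r) \<le> exp b" by auto
        then show ?case using True by simp
      qed
      then show ?thesis by (rule Lim_transform_eventually[OF tendsto_const])
    next
      case False
      then have "r \<notin> {exp (- b)..exp b}" for b
        by (meson atLeastAtMost_iff exp_gt_zero order_less_le_trans)
      then have "indicator {exp (- b)..exp b} r = (0 :: real)" for b by (simp add: indicator_def)
      then show ?thesis using False by (cases "r = 0") simp_all
    qed
    then show "AE r in lebesgue. ((\<lambda>b. indicator {exp (- b)..exp b} r *\<^sub>R ?h r) \<longlongrightarrow> indicator {0..} r *\<^sub>R ?h r) at_top"
      by simp
  qed (intro measurable_completion, measurable)+
  moreover have "(LINT r|lebesgue. indicator {exp (- b)..exp b} r *\<^sub>R ?h r) = integral {exp (- b)..exp b} ?h" for b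
  proof -
    have "set_integrable lebesgue {exp (- b)..exp b} ?h"
      by (rule set_integrable_subset[OF int]) (auto dest: order_trans[OF less_imp_le[OF exp_gt_zero]])
    then show ?thesis
      using set_lebesgue_integral_eq_integral(2) unfolding set_lebesgue_integral_def by blast
  qed
  moreover have "(LINT r|lebesgue. indicator {0..} r *\<^sub>R ?h r) = Gamma (- y)"
    using set_lebesgue_integral_eq_integral(2)[OF int] integral_unique[OF G]
    unfolding set_lebesgue_integral_def by simp
  ultimately have "((\<lambda>b. integral {exp (- b)..exp b} ?h) \<longlongrightarrow> Gamma (- y)) at_top"
    by simp
  then have lim: "((\<lambda>b. arc_mean (- b) (hankel_kernel y) + of_real (- sin (pi * y) / pi * integral {exp (- b)..exp b} ?h))
     \<longlongrightarrow> 0 + of_real (- sin (pi * y) / pi * Gamma (- y))) at_top"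
  proof (intro tendsto_intros)
    show "((\<lambda>b. arc_mean (- b) (hankel_kernel y)) \<longlongrightarrow> 0) at_top"
    proof (rule Lim_null_comparison)
      show "\<forall>\<^sub>F b in at_top. norm (arc_mean (- b) (hankel_kernel y)) \<le> exp (exp (- b) - y * - b)"
        using norm_arc_mean_hankel_le by (intro always_eventually allI)
      show "((\<lambda>b. exp (exp (- b) - y * - b)) \<longlongrightarrow> 0) at_top"
        using y by real_asymp
    qed
  qed
  have val: "- sin (pi * y) / pi * Gamma (- y) = rGamma (1 + y)"
  proof -
    have "rGamma (1 + y) * rGamma (1 - (1 + y)) = sin (pi * (1 + y)) / pi"
    proof -
      have "complex_of_real (rGamma (1 + y) * rGamma (1 - (1 + y))) = of_real (sin (pi * (1 + y)) / pi)"
        using rGamma_reflection_complex[of "of_real (1 + y)"]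
        by (simp only: of_real_mult of_real_divide of_real_diff of_real_1 rGamma_complex_of_real[symmetric] sin_of_real[symmetric])
      then show ?thesis by (simp only: of_real_eq_iff)
    qed
    moreover have "rGamma (- y) = inverse (Gamma (- y))" "Gamma (- y) > 0"
      using y by (auto simp: rGamma_inverse_Gamma)
    moreover have "sin (pi * (1 + y)) = - sin (pi * y)" by (simp add: ring_distribs)
    ultimately show ?thesis by (simp add: field_simps)
  qed
  have ev: "\<forall>\<^sub>F b in at_top. arc_mean (- b) (hankel_kernel y) + of_real (- sin (pi * y) / pi * integral {exp (- b)..exp b} ?h) = arc_mean b (hankel_kernel y)"
    using eventually_gt_at_top[of "0::real"]
  proof eventually_elim
    case (elim b)
    then show ?case
      using arc_mean_hankel_diff[of "-b" b y] integral_exp_substitution[of "-b" b y]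
      by (simp add: algebra_simps)
  qed
  show ?thesis
    using Lim_transform_eventually[OF lim ev] by (simp only: val add_0_left)
qed

text \<open>
  The kernel has period \<open>2 \<pi> \<i>\<close> for \<open>y = 0\<close>, so the mean does not depend on \<open>b\<close>; for \<open>b \<rightarrow> -\<infinity>\<close> the kernel
  tends to 1 uniformly on the segment.
\<close>
lemma arc_mean_hankel_0: "arc_mean b (hankel_kernel 0) = 1"
proof -
  have const: "arc_mean b (hankel_kernel 0) = arc_mean a (hankel_kernel 0)" for a
    using arc_mean_hankel_diff[of a b 0] arc_mean_hankel_diff[of b a 0]
    by (cases a b rule: linorder_cases) auto
  have one: "arc_mean a (\<lambda>_. 1) = 1" for a
  proof -
    have "Complex a pi - Complex a (- pi) = 2 * of_real pi * \<i>" by (simp add: complex_eq_iff)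
    then show ?thesis by (simp add: arc_mean_def)
  qed
  have diff: "arc_mean a (hankel_kernel 0) - 1 = arc_mean a (\<lambda>u. hankel_kernel 0 u - 1)" for a
  proof -
    have "arc_mean a (\<lambda>u. hankel_kernel 0 u - 1) = arc_mean a (hankel_kernel 0) - arc_mean a (\<lambda>_. 1)"
      unfolding arc_mean_def diff_divide_distrib[symmetric]
      by (subst contour_integral_diff)
         (auto intro!: contour_integrable_continuous_linepath continuous_hankel_kernel)
    then show ?thesis by (simp add: one)
  qed
  have "norm (arc_mean b (hankel_kernel 0) - 1) \<le> exp a * exp (exp a)" for a
    unfolding const[of a] diff
  proof (rule arc_mean_bound)
    fix z assume z: "Re z = a"
    have "norm (exp (exp z) - 1) \<le> norm (exp z) * exp (norm (exp z))"
      using Taylor_exp_field[of "exp z" 0] by (simp add: mult.commute)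
    then show "norm (hankel_kernel 0 z - 1) \<le> exp a * exp (exp a)"
      using z by (simp add: hankel_kernel_def)
  qed (intro continuous_intros continuous_hankel_kernel)
  moreover have "((\<lambda>a::real. exp a * exp (exp a)) \<longlongrightarrow> 0) at_bot"
    by real_asymp
  ultimately have "norm (arc_mean b (hankel_kernel 0) - 1) \<le> 0"
    by (intro tendsto_lowerbound[OF _ always_eventually]) auto
  then show ?thesis by simp
qed

text \<open>
  The recurrence reduces every \<open>y > -1\<close> to the interval \<open>-1 < y \<le> 0\<close>.
\<close>
lemma arc_mean_hankel_tendsto:
  assumes "y > -1"
  shows "((\<lambda>b. arc_mean b (hankel_kernel y)) \<longlongrightarrow> of_real (rGamma (1 + y))) at_top"
proof -
  have "-1 < y \<Longrightarrow> y \<le> real n \<Longrightarrow> ?thesis" for n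
  proof (induction n arbitrary: y)
    case 0
    then show ?case
      using arc_mean_hankel_tendsto_base[of y] by (cases "y = 0") (auto simp: arc_mean_hankel_0)
  next
    case (Suc n)
    show ?case
    proof (cases "y \<le> 0")
      case True
      then show ?thesis using Suc.prems
        arc_mean_hankel_tendsto_base[of y] by (cases "y = 0") (auto simp: arc_mean_hankel_0)
    next
      case False
      then have IH: "((\<lambda>b. arc_mean b (hankel_kernel (y - 1))) \<longlongrightarrow> of_real (rGamma y)) at_top"
        using Suc.IH[of "y - 1"] Suc.prems by simp
      have "((\<lambda>b. (arc_mean b (hankel_kernel (y - 1)) + of_real (exp (- exp b - y * b) * sin (pi * y) / pi)) / of_real y)
        \<longlongrightarrow> (of_real (rGamma y) + of_real (0 * sin (pi * y) / pi)) / of_real y) at_top"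
      proof (intro tendsto_intros IH)
        show "((\<lambda>b. exp (- exp b - y * b)) \<longlongrightarrow> 0) at_top"
          using False by real_asymp
      qed (use False in auto)
      moreover have "(arc_mean b (hankel_kernel (y - 1)) + of_real (exp (- exp b - y * b) * sin (pi * y) / pi)) / of_real y
        = arc_mean b (hankel_kernel y)" for b
        using arc_mean_hankel_recurrence[of b y] False by (simp add: field_simps)
      moreover have "rGamma y / y = rGamma (1 + y)"
        using rGamma_plus1[of y] False by (simp add: field_simps)
      ultimately show ?thesis using False
        by (simp flip: of_real_divide)
    qed
  qed
  from this[of "nat \<lceil>y\<rceil>"] show ?thesis using assms by linarith
qed

text \<open>
  Replacing \<open>b\<close> by a larger \<open>B\<close> changes the mean by the integral of the jump over \<open>[b, B]\<close>; now let
  \<open>B \<rightarrow> \<infinity>\<close>. The factor \<open>exp (- y b)\<close> makes the errors summable over \<open>y = p k\<close> with weights \<open>\<bar>z\<bar>\<^bsup>k\<^esup>\<close>,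
  and \<open>exp (- b)\<close> makes the sum vanish in the limit.
\<close>
lemma rGamma_minus_arc_mean_le:
  assumes "y \<ge> 0"
  shows "norm (of_real (rGamma (1 + y)) - arc_mean b (hankel_kernel y)) \<le> exp (- y * b - b)"
proof (rule tendsto_upperbound)
  show "((\<lambda>B. norm (arc_mean B (hankel_kernel y) - arc_mean b (hankel_kernel y))) \<longlongrightarrow>
    norm (of_real (rGamma (1 + y)) - arc_mean b (hankel_kernel y))) at_top"
    using assms by (intro tendsto_intros arc_mean_hankel_tendsto) auto
  show "\<forall>\<^sub>F B in at_top. norm (arc_mean B (hankel_kernel y) - arc_mean b (hankel_kernel y)) \<le> exp (- y * b - b)"
    using eventually_gt_at_top[of b]
  proof eventually_elim
    case (elim B)
    have prim: "((\<lambda>x. exp (- y * b) * exp (- x)) has_integral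
       (exp (- y * b) * - exp (- B) - exp (- y * b) * - exp (- b))) {b..B}"
      using elim by (intro fundamental_theorem_of_calculus)
        (auto intro!: derivative_eq_intros simp flip: has_real_derivative_iff_has_vector_derivative)
    have "integral {b..B} (\<lambda>x. exp (- exp x - y * x)) \<le> integral {b..B} (\<lambda>x. exp (- y * b) * exp (- x))"
    proof (intro integral_le integrable_continuous_real continuous_intros)
      fix x assume x: "x \<in> {b..B}"
      have "- exp x \<le> - x" using exp_ge_add_one_self[of x] by linarith
      moreover have "y * b \<le> y * x" using x assms by (intro mult_left_mono) auto
      ultimately show "exp (- exp x - y * x) \<le> exp (- y * b) * exp (- x)"
        by (simp flip: exp_add)
    qed
    also have "\<dots> = exp (- y * b) * exp (- b) - exp (- y * b) * exp (- B)"
      using integral_unique[OF prim] by simp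
    also have "\<dots> \<le> exp (- y * b - b)" by (simp add: exp_diff exp_minus field_simps)
    finally have "integral {b..B} (\<lambda>x. exp (- exp x - y * x)) \<le> exp (- y * b - b)" .
    moreover have "0 \<le> integral {b..B} (\<lambda>x. exp (- exp x - y * x))"
      by (intro integral_nonneg integrable_continuous_real continuous_intros) auto
    moreover have "\<bar>sin (pi * y) / pi\<bar> \<le> 1" 
      using order_trans[OF abs_sin_le_one[of "pi * y"], of pi] pi_ge_two by (simp add: field_simps)
    ultimately have "\<bar>sin (pi * y) / pi\<bar> * integral {b..B} (\<lambda>x. exp (- exp x - y * x)) \<le> 1 * exp (- y * b - b)"
      by (intro mult_mono) auto
    then show ?case
      unfolding arc_mean_hankel_diff[OF elim] norm_of_real abs_mult using \<open>0 \<le> integral _ _\<close> by simp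
  qed
qed simp

section \<open>Asymptotics of the Mittag-Leffler function in a sector\<close>

definition ml_fps :: "real \<Rightarrow> real \<Rightarrow> complex fps" where
  "ml_fps p \<beta> = Abs_fps (\<lambda>k. of_real (1 / Gamma (p * real k + \<beta>)))"

text \<open>
  Because \<open>b\<close> is arbitrary, the coefficients \<open>1 / \<Gamma>(p k + 1)\<close> decay faster than any geometric sequence.
\<close>
lemma norm_rGamma_le:
  fixes y :: real
  assumes "y \<ge> 0"
  shows "\<bar>rGamma (1 + y)\<bar> \<le> (exp (- b) + exp (exp b)) * exp (- y * b)"
proof -
  have "norm (complex_of_real (rGamma (1 + y))) \<le>
      norm (of_real (rGamma (1 + y)) - arc_mean b (hankel_kernel y)) + norm (arc_mean b (hankel_kernel y))"
    by (metis diff_add_cancel norm_triangle_ineq)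
  also have "\<dots> \<le> exp (- y * b - b) + exp (exp b - y * b)"
    by (intro add_mono rGamma_minus_arc_mean_le norm_arc_mean_hankel_le assms)
  also have "\<dots> = (exp (- b) + exp (exp b)) * exp (- y * b)"
    by (simp add: exp_diff exp_minus field_simps)
  finally show ?thesis by simp
qed

lemma fps_conv_radius_ml_1:
  assumes p: "0 < p"
  shows "fps_conv_radius (ml_fps p 1) = \<infinity>"
  unfolding fps_conv_radius_def
proof (rule conv_radius_inftyI'')
  fix z :: complex
  \<comment> \<open>chosen so that \<open>\<bar>z\<bar> exp (- p b) < 1 / 2\<close>\<close>
  define b where "b = ln (2 * norm z + 1) / p"
  have pos: "2 * norm z + 1 > 0" using norm_ge_zero[of z] by linarith
  have "p * b = ln (2 * norm z + 1)" using p by (simp add: b_def)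
  then have b: "exp (p * b) = 2 * norm z + 1" using pos by (metis exp_ln)
  define q where "q = norm z / (2 * norm z + 1)"
  have q: "0 \<le> q" "q < 1"
    unfolding q_def divide_less_eq_1_pos[OF pos] using pos norm_ge_zero[of z] by (simp, linarith)
  show "summable (\<lambda>k. fps_nth (ml_fps p 1) k * z ^ k)"
  proof (rule summable_comparison_test')
    show "summable (\<lambda>k. (exp (- b) + exp (exp b)) * q ^ k)"
      using q by (intro summable_mult summable_geometric) auto
    fix k :: nat
    have "norm (fps_nth (ml_fps p 1) k * z ^ k) = \<bar>rGamma (1 + p * real k)\<bar> * norm z ^ k"
      by (simp add: ml_fps_def norm_mult norm_power rGamma_inverse_Gamma divide_inverse add.commute norm_inverse)
    also have "\<dots> \<le> (exp (- b) + exp (exp b)) * exp (- (p * real k) * b) * norm z ^ k"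
      using p norm_rGamma_le[of "p * real k" b] by (intro mult_right_mono) auto
    also have "exp (- (p * real k) * b) = 1 / exp (p * b) ^ k"
      by (simp add: exp_minus divide_inverse mult_ac flip: exp_of_nat_mult)
    finally show "norm (fps_nth (ml_fps p 1) k * z ^ k) \<le> (exp (- b) + exp (exp b)) * q ^ k"
      by (simp add: q_def b power_divide)
  qed
qed

text \<open>
  In the coefficients this is \<open>\<Gamma>(x + 1) = x \<Gamma>(x)\<close>. It reduces \<open>E\<^bsub>p,p\<^esub>\<close> to \<open>E\<^sub>p\<close>, both for convergence and for
  the estimates.
\<close>
lemma fps_deriv_ml:
  assumes p: "0 < p"
  shows "fps_deriv (ml_fps p 1) = fps_const (of_real (1 / p)) * ml_fps p p"
proof (rule fps_ext)
  fix k
  define x where "x = real (k + 1)"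
  have x: "x > 0" "p * real k + p = p * x" by (auto simp: x_def ring_distribs)
  have "p * x > 0" using p x by simp
  then have "p * x \<notin> \<int>\<^sub>\<le>\<^sub>0" using nonpos_Ints_nonpos[of "p * x"] by auto
  then have "Gamma (p * x + 1) = (p * x) * Gamma (p * x)" by (rule Gamma_plus1)
  then have "x * (1 / Gamma (p * x + 1)) = 1 / p * (1 / Gamma (p * x))"
    using p x by simp
  then have "real (k + 1) * (1 / Gamma (p * real (k + 1) + 1)) = 1 / p * (1 / Gamma (p * real k + p))"
    unfolding x(2) by (simp only: x_def)
  then show "fps_nth (fps_deriv (ml_fps p 1)) k = fps_nth (fps_const (of_real (1 / p)) * ml_fps p p) k"
    unfolding ml_fps_def fps_deriv_nth fps_nth_Abs_fps fps_mult_left_const_nth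
    by (metis of_real_mult of_real_of_nat_eq)
qed

lemma fps_conv_radius_ml_p:
  assumes p: "0 < p"
  shows "fps_conv_radius (ml_fps p p) = \<infinity>"
proof -
  have "ml_fps p p = fps_const (of_real p) * fps_deriv (ml_fps p 1)"
    using p unfolding fps_deriv_ml[OF p] mult.assoc[symmetric] fps_const_mult
    by (simp flip: of_real_mult)
  then show ?thesis
    using fps_conv_radius_deriv[of "ml_fps p 1"] fps_conv_radius_ml_1[OF p]
      fps_conv_radius_mult[of "fps_const (of_real p)" "fps_deriv (ml_fps p 1)"]
    by simp
qed

definition mittag_leffler :: "real \<Rightarrow> real \<Rightarrow> complex \<Rightarrow> complex" where
  "mittag_leffler p \<beta> = eval_fps (ml_fps p \<beta>)"

text \<open>
  The sum over \<open>k\<close> of \<open>z\<^bsup>k\<^esup>\<close> times the kernel for \<open>y = p k\<close>, as a geometric series; in the variable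
  \<open>q = exp u\<close> it is \<open>exp q \<cdot> q\<^bsup>p-1\<^esup> / (q\<^bsup>p\<^esup> - z) dq\<close>.
\<close>
definition ml_integrand :: "real \<Rightarrow> complex \<Rightarrow> complex \<Rightarrow> complex" where
  "ml_integrand p z u = exp (exp u) * exp (of_real p * u) / (exp (of_real p * u) - z)"

lemma arc_mean_ml_integrand_sums:
  assumes p: "0 < p" and z: "norm z < exp (p * b)"
  shows "(\<lambda>k. z ^ k * arc_mean b (hankel_kernel (p * real k))) sums arc_mean b (ml_integrand p z)"
proof -
  let ?s = "closed_segment (Complex b (- pi)) (Complex b pi)"
  let ?l = "linepath (Complex b (- pi)) (Complex b pi)"
  let ?f = "\<lambda>k u. z ^ k * hankel_kernel (p * real k) u"
  define q where "q = norm z / exp (p * b)"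
  have q: "0 \<le> q" "q < 1" using z by (auto simp: q_def)
  have Re: "Re u = b" if "u \<in> ?s" for u using that closed_segment_Complex_Re[of "- pi" pi b] by auto
  have bound: "norm (?f k u) \<le> exp (exp b) * q ^ k" if "u \<in> ?s" for k u
  proof -
    have "norm (?f k u) \<le> norm z ^ k * exp (exp b - (p * real k) * b)"
      using norm_hankel_kernel_le[of "p * real k" u] Re[OF that]
      by (simp add: norm_mult norm_power mult_left_mono)
    also have "\<dots> = exp (exp b) * q ^ k"
      by (simp add: q_def power_divide exp_diff mult_ac flip: exp_of_nat_mult)
    finally show ?thesis .
  qed
  have unif: "uniform_limit ?s (\<lambda>N u. \<Sum>k<N. ?f k u) (\<lambda>u. \<Sum>k. ?f k u) sequentially"
    using bound q by (intro Weierstrass_m_test[where M = "\<lambda>k. exp (exp b) * q ^ k"] summable_mult summable_geometric) auto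
  have sum_eq: "(\<Sum>k. ?f k u) = ml_integrand p z u" if "u \<in> ?s" for u
  proof -
    define w where "w = exp (of_real p * u)"
    have w: "w \<noteq> 0" "norm w = exp (p * b)" by (auto simp: w_def Re[OF that])
    have "norm (z / w) < 1" using w z by (simp add: norm_divide)
    then have "(\<lambda>k. exp (exp u) * (z / w) ^ k) sums (exp (exp u) * (1 / (1 - z / w)))"
      by (intro sums_mult geometric_sums)
    moreover have "exp (exp u) * (z / w) ^ k = ?f k u" for k
      by (simp add: hankel_kernel_def exp_diff w_def power_divide mult_ac flip: exp_of_nat_mult)
    moreover have "w - z \<noteq> 0" using w z by auto
    then have "exp (exp u) * (1 / (1 - z / w)) = ml_integrand p z u"
      using w unfolding ml_integrand_def w_def[symmetric] by (simp add: divide_simps)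
    ultimately show ?thesis by (simp add: sums_iff)
  qed
  obtain J where J: "((\<lambda>u. \<Sum>k. ?f k u) has_contour_integral J) ?l"
    "(\<lambda>k. contour_integral ?l (?f k)) sums J"
    by (rule contour_integral_sums_linepath[OF unif]) (intro continuous_intros continuous_hankel_kernel)
  have "contour_integral ?l (ml_integrand p z) = J"
    using has_contour_integral_eq[OF J(1)] sum_eq by (auto intro!: contour_integral_unique)
  moreover have "contour_integral ?l (?f k) = z ^ k * contour_integral ?l (hankel_kernel (p * real k))" for k
    by (intro contour_integral_lmul contour_integrable_continuous_linepath continuous_hankel_kernel)
  ultimately show ?thesis
    using sums_divide[OF J(2), of "2 * of_real pi * \<i>"] by (simp add: arc_mean_def)
qed

lemma ml_minus_arc_mean_le:
  assumes p: "0 < p" and z: "2 * norm z \<le> exp (p * b)"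
  shows "norm (mittag_leffler p 1 z - arc_mean b (ml_integrand p z)) \<le> 2 * exp (- b)"
proof -
  define q where "q = norm z / exp (p * b)"
  have q: "0 \<le> q" "q \<le> 1 / 2" using z by (auto simp: q_def field_simps)
  have z': "norm z < exp (p * b)" using z norm_ge_zero[of z] exp_gt_zero[of "p * b"] by linarith
  let ?a = "\<lambda>k. fps_nth (ml_fps p 1) k * z ^ k - z ^ k * arc_mean b (hankel_kernel (p * real k))"
  have "(\<lambda>k. fps_nth (ml_fps p 1) k * z ^ k) sums mittag_leffler p 1 z"
    unfolding mittag_leffler_def using fps_conv_radius_ml_1[OF p]
    by (intro sums_eval_fps) auto
  then have sums: "?a sums (mittag_leffler p 1 z - arc_mean b (ml_integrand p z))"
    by (intro sums_diff arc_mean_ml_integrand_sums p z')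
  have le: "norm (?a k) \<le> exp (- b) * q ^ k" for k
  proof -
    have "?a k = z ^ k * (of_real (rGamma (1 + p * real k)) - arc_mean b (hankel_kernel (p * real k)))"
      by (simp add: ml_fps_def rGamma_inverse_Gamma divide_inverse add.commute algebra_simps)
    also have "norm \<dots> \<le> norm z ^ k * exp (- (p * real k) * b - b)"
      unfolding norm_mult norm_power using p by (intro mult_left_mono rGamma_minus_arc_mean_le) auto
    also have "\<dots> = exp (- b) * q ^ k"
    proof -
      have "exp (p * b) ^ k = exp (p * real k * b)" by (simp add: mult_ac flip: exp_of_nat_mult)
      then show ?thesis by (simp add: q_def power_divide exp_diff exp_minus field_simps)
    qed
    finally show ?thesis .
  qed
  have geo: "(\<lambda>k. exp (- b) * q ^ k) sums (exp (- b) * (1 / (1 - q)))"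
    using q by (intro sums_mult geometric_sums) auto
  have "norm (\<Sum>k. ?a k) \<le> (\<Sum>k. exp (- b) * q ^ k)"
    using le geo by (intro norm_suminf_le) (auto simp: sums_iff)
  then have "norm (mittag_leffler p 1 z - arc_mean b (ml_integrand p z)) \<le> exp (- b) * (1 / (1 - q))"
    using sums geo by (simp add: sums_iff)
  also have "\<dots> \<le> exp (- b) * 2"
    using q by (intro mult_left_mono) (auto simp: divide_simps)
  finally show ?thesis by simp
qed

text \<open>
  The angle between \<open>z\<close> and the ray of argument \<open>\<plusminus> p \<pi>\<close> lies between \<open>p \<pi> / 2\<close> and \<open>3 p \<pi> / 2\<close>, below \<open>3 \<pi> / 2\<close>, so
  its cosine is at most \<open>cos (p \<pi> / 2)\<close>, and completing the square gives the distance.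
\<close>
lemma norm_diff_ray_ge:
  fixes z :: complex
  assumes p: "0 < p" "p < 1" and arg: "\<bar>Arg z\<bar> \<le> p * pi / 2" and r: "r \<ge> 0" and s: "\<bar>s\<bar> = p * pi"
  shows "norm (of_real r * cis s - z) \<ge> sin (p * pi / 2) * norm z"
proof -
  define C where "C = cos (p * pi / 2)"
  define a where "a = s - Arg z"
  have "p * pi < 1 * pi" using p by (intro mult_strict_right_mono) auto
  then have lt: "p * pi / 2 < pi / 2" "p * pi > 0" using p by auto
  have C: "C > 0" unfolding C_def using lt pi_gt_zero by (intro cos_gt_zero_pi) linarith+
  have a: "p * pi / 2 \<le> \<bar>a\<bar>" "\<bar>a\<bar> \<le> 3 * (p * pi / 2)" using arg s unfolding a_def by linarith+
  have cos: "cos a \<le> C"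
  proof (cases "\<bar>a\<bar> \<le> pi")
    case True
    then have "cos \<bar>a\<bar> \<le> cos (p * pi / 2)" using a lt by (intro cos_monotone_0_pi_le) auto
    then show ?thesis by (simp add: C_def)
  next
    case False
    have "cos (\<bar>a\<bar> - pi) \<ge> 0" using False a(2) lt(1) pi_gt_zero by (intro cos_ge_zero) linarith+
    then have "cos \<bar>a\<bar> \<le> 0" by (simp add: cos_diff)
    then show ?thesis using C by simp
  qed
  have z: "z = of_real (norm z) * cis (Arg z)"
    by (metis rcis_cmod_Arg rcis_def)
  have "(norm (of_real r * cis s - z))\<^sup>2 = r\<^sup>2 - 2 * r * norm z * cos a + (norm z)\<^sup>2"
  proof -
    have expand: "(r * a - R * c)\<^sup>2 + (r * b - R * d)\<^sup>2 =
        r\<^sup>2 * (b\<^sup>2 + a\<^sup>2) - 2 * r * R * (a * c + b * d) + R\<^sup>2 * (d\<^sup>2 + c\<^sup>2)" for a b c d R :: real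
      by (simp add: power2_eq_square algebra_simps)
    have "(norm (of_real r * cis s - z))\<^sup>2 = (r * cos s - norm z * cos (Arg z))\<^sup>2 + (r * sin s - norm z * sin (Arg z))\<^sup>2"
      by (subst z) (simp add: cmod_power2)
    also have "\<dots> = r\<^sup>2 * ((sin s)\<^sup>2 + (cos s)\<^sup>2) - 2 * r * norm z * (cos s * cos (Arg z) + sin s * sin (Arg z))
       + (norm z)\<^sup>2 * ((sin (Arg z))\<^sup>2 + (cos (Arg z))\<^sup>2)"
      by (rule expand)
    finally show ?thesis by (simp add: a_def cos_diff)
  qed
  also have "\<dots> \<ge> r\<^sup>2 - 2 * r * norm z * C + (norm z)\<^sup>2"
    using cos r by (intro add_right_mono diff_left_mono mult_left_mono) auto
  also have "r\<^sup>2 - 2 * r * norm z * C + (norm z)\<^sup>2 = (r - norm z * C)\<^sup>2 + (norm z)\<^sup>2 * (1 - C\<^sup>2)"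
    by (simp add: power2_eq_square algebra_simps)
  also have "\<dots> \<ge> (norm z)\<^sup>2 * (1 - C\<^sup>2)" by simp
  also have "1 - C\<^sup>2 = (sin (p * pi / 2))\<^sup>2" by (simp add: C_def sin_squared_eq)
  finally have "(sin (p * pi / 2) * norm z)\<^sup>2 \<le> (norm (of_real r * cis s - z))\<^sup>2"
    by (simp add: power_mult_distrib mult.commute)
  then show ?thesis by (rule power2_le_imp_le) simp
qed

lemma ml_integrand_edge_le:
  assumes p: "0 < p" "p < 1" and arg: "\<bar>Arg z\<bar> \<le> p * pi / 2" and z: "z \<noteq> 0" and x: "x \<ge> 0"
    and s: "s = pi \<or> s = - pi"
  shows "norm (ml_integrand p z (Complex x s)) \<le> exp (x - exp x) / (sin (p * pi / 2) * norm z)"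
proof -
  have "p * pi < 1 * pi" using p by (intro mult_strict_right_mono) auto
  then have sin: "sin (p * pi / 2) > 0" using p by (intro sin_gt_zero) auto
  have q: "exp (of_real p * Complex x s) = of_real (exp (p * x)) * cis (p * s)"
    unfolding cis_conv_exp exp_of_real[symmetric] exp_add[symmetric] by (simp add: Complex_eq algebra_simps)
  have "norm (exp (of_real p * Complex x s) - z) \<ge> sin (p * pi / 2) * norm z"
    unfolding q using p s by (intro norm_diff_ray_ge arg) (auto simp: abs_mult)
  moreover have "norm (exp (exp (Complex x s))) = exp (- exp x)"
    using s exp_Complex_pi by (auto simp: norm_exp_eq_Re)
  moreover have "norm (exp (of_real p * Complex x s)) \<le> exp x"
    using mult_right_mono[of p 1 x] p x by (simp add: norm_exp_eq_Re)
  ultimately have "norm (ml_integrand p z (Complex x s)) \<le> (exp (- exp x) * exp x) / (sin (p * pi / 2) * norm z)"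
    unfolding ml_integrand_def norm_mult norm_divide using sin z by (intro frac_le mult_mono) auto
  then show ?thesis by (simp add: exp_diff exp_minus field_simps)
qed

text \<open>
  Residue theorem on the rectangle with \<open>0 \<le> Re u \<le> b\<close>. The poles are the points
  \<open>(Ln z + 2 \<pi> \<i> n) / p\<close>; because \<open>p < 1\<close>, only \<open>n = 0\<close> lies in the strip, and its residue is the
  exponential term.
\<close>
lemma arc_mean_ml_integrand_eq:
  assumes p: "0 < p" "p < 1" and arg: "\<bar>Arg z\<bar> \<le> p * pi / 2" and z: "norm z > 1"
    and b: "norm z < exp (p * b)"
  shows "arc_mean b (ml_integrand p z) = 1 / of_real p * exp (z powr of_real (1 / p)) +
     arc_mean 0 (ml_integrand p z) +
     integral {0..b} (\<lambda>x. ml_integrand p z (Complex x pi) - ml_integrand p z (Complex x (- pi)))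
       / (2 * of_real pi * \<i>)"
proof -
  have z0: "z \<noteq> 0" using z by auto
  define u0 where "u0 = Ln z / of_real p"
  have eu0: "exp (of_real p * u0) = z" using p z0 by (simp add: u0_def)
  have ppi: "p * pi < 1 * pi" using p by (intro mult_strict_right_mono) auto
  have Re0: "0 < Re u0" "Re u0 < b"
  proof -
    show "0 < Re u0" using z p z0 by (simp add: u0_def)
    have "ln (norm z) < p * b" using b z0 by (metis exp_less_cancel_iff exp_ln zero_less_norm_iff)
    then show "Re u0 < b" using p z0 by (simp add: u0_def field_simps)
  qed
  have b0: "0 < b" using Re0 by linarith
  have Im0: "\<bar>Im u0\<bar> \<le> pi / 2"
    using arg p z0 by (simp add: u0_def Arg_eq_Im_Ln field_simps abs_if split: if_splits)
  let ?R = "rectpath (Complex 0 (- pi)) (Complex b pi)"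
  \<comment> \<open>an open strip that contains the closed rectangle but none of the other poles\<close>
  define S where "S = {u. \<bar>Im u\<bar> < pi * (2 - p) / p}"
  have pS: "pi < pi * (2 - p) / p" using p by (simp add: field_simps)
  have S: "open S" "connected S"
  proof -
    have eq: "S = {u. Im u < pi * (2 - p) / p} \<inter> {u. Im u > - (pi * (2 - p) / p)}" by (auto simp: S_def)
    show "open S" unfolding eq by (intro open_Int open_halfspace_Im_lt open_halfspace_Im_gt)
    show "connected S" unfolding eq
      by (intro convex_connected convex_Int convex_halfspace_Im_lt convex_halfspace_Im_gt)
  qed
  have u0S: "u0 \<in> S" using Im0 pS pi_gt_zero unfolding S_def mem_Collect_eq by linarith
  have only: "u = u0" if "u \<in> S" "exp (of_real p * u) = z" for u
  proof -
    have "exp (of_real p * u) = exp (Ln z)" using that z0 by simp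
    then obtain n :: int where n: "of_real p * u = Ln z + of_int (2 * n) * pi * \<i>"
      by (auto simp: exp_eq)
    have "p * Im u = Arg z + 2 * of_int n * pi"
      using arg_cong[OF n, of Im] z0 by (simp add: Arg_eq_Im_Ln)
    moreover have "p * \<bar>Im u\<bar> < pi * (2 - p)" using that(1) p by (simp add: S_def field_simps)
    then have "\<bar>p * Im u\<bar> < pi * (2 - p)" using p by (simp add: abs_mult)
    ultimately have "\<bar>2 * of_int n * pi\<bar> < pi * (2 - p) + p * pi / 2" using arg by linarith
    also have "\<dots> < 2 * pi" using p by (simp add: algebra_simps)
    finally have "\<bar>real_of_int n\<bar> * (2 * pi) < 1 * (2 * pi)" by (simp add: abs_mult)
    then have "n = 0" by simp
    then show ?thesis using n p unfolding u0_def by (simp add: field_simps)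
  qed
  have box: "cbox (Complex 0 (- pi)) (Complex b pi) \<subseteq> S"
    using pS unfolding S_def by (auto simp: in_cbox_complex_iff)
  have u0box: "u0 \<in> box (Complex 0 (- pi)) (Complex b pi)"
  proof -
    have "- pi < Im u0" "Im u0 < pi" using Im0 pi_gt_zero by linarith+
    then show ?thesis using Re0 by (simp add: in_box_complex_iff)
  qed
  have img: "path_image ?R \<subseteq> cbox (Complex 0 (- pi)) (Complex b pi)" "u0 \<notin> path_image ?R"
    using path_image_rectpath_subset_cbox[of "Complex 0 (- pi)" "Complex b pi"] b0
      path_image_rectpath_cbox_minus_box[of "Complex 0 (- pi)" "Complex b pi"] u0box by auto
  have holo: "ml_integrand p z holomorphic_on (S - {u0})"
    unfolding ml_integrand_def using only by (intro holomorphic_intros) auto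
  have res: "residue (ml_integrand p z) u0 = 1 / of_real p * exp (z powr of_real (1 / p))"
  proof -
    have "residue (\<lambda>u. (exp (exp u) * exp (of_real p * u)) / (exp (of_real p * u) - z)) u0 =
       (exp (exp u0) * exp (of_real p * u0)) / (of_real p * z)"
      using S u0S p z0 by (intro residue_simple_pole_deriv[where s = S])
        (auto intro!: holomorphic_intros derivative_eq_intros simp: eu0)
    moreover have "exp u0 = z powr of_real (1 / p)" using z0 by (simp add: powr_def u0_def)
    ultimately show ?thesis unfolding ml_integrand_def eu0 using z0 by (simp add: mult.commute)
  qed
  have "contour_integral ?R (ml_integrand p z) =
    2 * pi * \<i> * (\<Sum>w\<in>{u0}. winding_number ?R w * residue (ml_integrand p z) w)"
    using S holo img box b0 by (intro Residue_theorem)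
      (auto intro!: winding_number_rectpath_outside)
  then have "contour_integral ?R (ml_integrand p z) = 2 * pi * \<i> * (1 / of_real p * exp (z powr of_real (1 / p)))"
    using winding_number_rectpath[OF u0box] res by simp
  moreover have "contour_integral ?R (ml_integrand p z) =
    2 * of_real pi * \<i> * (arc_mean b (ml_integrand p z) - arc_mean 0 (ml_integrand p z))
      - integral {0..b} (\<lambda>x. ml_integrand p z (Complex x pi) - ml_integrand p z (Complex x (- pi)))"
    using holo img box b0
    by (intro contour_integral_strip_rectpath continuous_on_subset[OF holomorphic_on_imp_continuous_on[OF holo]]) auto
  ultimately show ?thesis
    by (simp add: field_simps)
qed

text \<open>
  The mean over \<open>Re u = 0\<close> is \<open>O(1/\<bar>z\<bar>)\<close> since \<open>\<bar>exp (p u)\<bar> = 1\<close> there. So is the integral of the jump: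
  on the horizontal sides the denominator is at least \<open>sin (p \<pi> / 2) \<bar>z\<bar>\<close> in modulus, and the rest
  of the integrand is integrable. The error of replacing \<open>E\<^sub>p(z)\<close> by
  the mean at \<open>b\<close> vanishes as \<open>b \<rightarrow> \<infinity>\<close>.
\<close>
lemma ml_asymptotics:
  assumes p: "0 < p" "p < 1"
  obtains C where "C \<ge> 0"
    "\<And>z. norm z \<ge> 2 \<Longrightarrow> \<bar>Arg z\<bar> \<le> p * pi / 2 \<Longrightarrow>
      norm (mittag_leffler p 1 z - 1 / of_real p * exp (z powr of_real (1 / p))) \<le> C / norm z"
proof
  define c where "c = sin (p * pi / 2)"
  have "p * pi < 1 * pi" using p by (intro mult_strict_right_mono) auto
  then have c: "c > 0" unfolding c_def using p by (intro sin_gt_zero) auto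
  let ?C = "2 * exp 1 + 2 / c"
  show "?C \<ge> 0" using c by simp
  fix z :: complex
  assume z: "norm z \<ge> 2" and arg: "\<bar>Arg z\<bar> \<le> p * pi / 2"
  then have z0: "z \<noteq> 0" by auto
  let ?g = "ml_integrand p z"
  let ?D = "mittag_leffler p 1 z - 1 / of_real p * exp (z powr of_real (1 / p))"
  have arc0: "norm (arc_mean 0 ?g) \<le> 2 * exp 1 / norm z"
  proof (rule arc_mean_bound)
    have ne: "exp (of_real p * u) - z \<noteq> 0" if "Re u = 0" for u
    proof
      assume "exp (of_real p * u) - z = 0"
      then have "norm (exp (of_real p * u)) = norm z" by simp
      then show False using that z by (simp add: norm_exp_eq_Re)
    qed
    show "continuous_on {u. Re u = 0} ?g"
      unfolding ml_integrand_def using ne by (intro continuous_intros) auto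
    fix u assume u: "Re u = 0"
    have "norm (exp (of_real p * u) - z) \<ge> norm z / 2"
      using norm_triangle_ineq2[of z "exp (of_real p * u)"] u z by (simp add: norm_exp_eq_Re norm_minus_commute)
    moreover have "norm (exp (exp u)) \<le> exp 1" using u by (simp add: norm_exp_eq_Re Re_exp)
    ultimately have "norm (?g u) \<le> exp 1 / (norm z / 2)"
      unfolding ml_integrand_def norm_mult norm_divide using u z by (intro frac_le) (auto simp: norm_exp_eq_Re)
    then show "norm (?g u) \<le> 2 * exp 1 / norm z" by (simp add: field_simps)
  qed
  have "norm ?D \<le> ?C / norm z + 2 * exp (- b)" if b: "2 * norm z \<le> exp (p * b)" for b
  proof -
    have b1: "norm z < exp (p * b)" using b z by linarith
    then have "1 < exp (p * b)" using z by linarith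
    then have b0: "b > 0" using p by (simp add: zero_less_mult_iff)
    let ?H = "integral {0..b} (\<lambda>x. ?g (Complex x pi) - ?g (Complex x (- pi)))"
    have prim: "((\<lambda>x. 2 / (c * norm z) * exp (x - exp x)) has_integral
       (2 / (c * norm z) * - exp (- exp b) - 2 / (c * norm z) * - exp (- exp 0))) {0..b}"
      using b0 c z0 by (intro fundamental_theorem_of_calculus)
        (auto intro!: derivative_eq_intros simp: exp_diff exp_minus field_simps simp flip: has_real_derivative_iff_has_vector_derivative)
    have "norm ?H \<le> integral {0..b} (\<lambda>x. 2 / (c * norm z) * exp (x - exp x))"
    proof (rule integral_norm_bound_integral)
      show "(\<lambda>x. 2 / (c * norm z) * exp (x - exp x)) integrable_on {0..b}" using prim by blast
      show "(\<lambda>x. ?g (Complex x pi) - ?g (Complex x (- pi))) integrable_on {0..b}"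
      proof (intro integrable_continuous_real continuous_intros)
        have "continuous_on {0..b} (\<lambda>x. ?g (Complex x s))" if "s = pi \<or> s = - pi" for s
        proof -
          have "exp (of_real p * (of_real x + \<i> * of_real s)) - z \<noteq> 0" for x
          proof -
            have "sin (p * pi / 2) * norm z \<le> norm (of_real (exp (p * x)) * cis (p * s) - z)"
              using that p by (intro norm_diff_ray_ge arg) (auto simp: abs_mult)
            moreover have "sin (p * pi / 2) * norm z > 0" using c z0 by (simp add: c_def)
            ultimately have "of_real (exp (p * x)) * cis (p * s) - z \<noteq> 0" by auto
            moreover have "of_real (exp (p * x)) * cis (p * s) = exp (of_real p * (of_real x + \<i> * of_real s))"
              unfolding cis_conv_exp exp_of_real[symmetric] exp_add[symmetric] by (simp add: algebra_simps)
            ultimately show ?thesis by simp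
          qed
          then show ?thesis unfolding ml_integrand_def Complex_eq by (intro continuous_intros) auto
        qed
        then show "continuous_on {0..b} (\<lambda>x. ?g (Complex x pi))" "continuous_on {0..b} (\<lambda>x. ?g (Complex x (- pi)))"
          by auto
      qed
      fix x assume x: "x \<in> {0..b}"
      have "norm (?g (Complex x pi) - ?g (Complex x (- pi))) \<le>
          exp (x - exp x) / (c * norm z) + exp (x - exp x) / (c * norm z)"
        unfolding c_def using x z0
        by (intro order_trans[OF norm_triangle_ineq4] add_mono ml_integrand_edge_le p arg) auto
      then show "norm (?g (Complex x pi) - ?g (Complex x (- pi))) \<le> 2 / (c * norm z) * exp (x - exp x)"
        by simp
    qed
    also have "\<dots> = 2 / (c * norm z) * (exp (- 1) - exp (- exp b))"
      unfolding integral_unique[OF prim] by (simp add: right_diff_distrib diff_divide_distrib)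
    also have "\<dots> \<le> 2 / (c * norm z) * 1"
      using c by (intro mult_left_mono) (auto intro: order_trans[of _ "exp (-1)"])
    finally have H: "norm ?H \<le> 2 / (c * norm z)" by simp
    have "norm (?H / (2 * of_real pi * \<i>)) = norm ?H / (2 * pi)"
      by (simp add: norm_divide norm_mult)
    also have "\<dots> \<le> norm ?H / 1" using pi_ge_two by (intro divide_left_mono) auto
    finally have H': "norm (?H / (2 * of_real pi * \<i>)) \<le> 2 / (c * norm z)" using H by simp
    have "?D = (mittag_leffler p 1 z - arc_mean b ?g) + (arc_mean 0 ?g + ?H / (2 * of_real pi * \<i>))"
      using arc_mean_ml_integrand_eq[OF p arg _ b1] z by simp
    also have "norm \<dots> \<le> 2 * exp (- b) + (2 * exp 1 / norm z + 2 / (c * norm z))"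
      by (intro norm_triangle_le add_mono ml_minus_arc_mean_le p b arc0 H')
    also have "\<dots> = ?C / norm z + 2 * exp (- b)" by (simp add: add_divide_distrib)
    finally show ?thesis .
  qed
  moreover have "\<forall>\<^sub>F b in at_top. 2 * norm z \<le> exp (p * b)"
  proof -
    have "filterlim (\<lambda>b. exp (p * b)) at_top at_top" using p by real_asymp
    then show ?thesis by (simp add: filterlim_at_top)
  qed
  ultimately have ev: "\<forall>\<^sub>F b in at_top. norm ?D \<le> ?C / norm z + 2 * exp (- b)"
    by (auto elim: eventually_mono)
  have "((\<lambda>b. ?C / norm z + 2 * exp (- b)) \<longlongrightarrow> ?C / norm z + 2 * 0) at_top"
    by (intro tendsto_intros) real_asymp
  from tendsto_lowerbound[OF this ev] show "norm ?D \<le> ?C / norm z" by simp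
qed

section \<open>Taylor coefficients, Toeplitz blocks and block diagonal matrices\<close>

definition taylor_coeff :: "(complex \<Rightarrow> complex) \<Rightarrow> complex \<Rightarrow> nat \<Rightarrow> complex" where
  "taylor_coeff f z m = (deriv ^^ m) f z / fact m"

lemma taylor_coeff_mult:
  assumes "open S" "f holomorphic_on S" "g holomorphic_on S" "z \<in> S"
  shows "taylor_coeff (\<lambda>w. f w * g w) z m = (\<Sum>i\<le>m. taylor_coeff f z i * taylor_coeff g z (m - i))"
proof -
  have "of_nat (m choose i) * a * b / fact m = (a / fact i) * (b / fact (m - i))" if "i \<le> m" for i and a b :: complex
    using that by (simp add: binomial_fact)
  then show ?thesis
    unfolding taylor_coeff_def higher_deriv_mult[OF assms(2,3,1,4)] sum_divide_distrib atMost_atLeast0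
    by (intro sum.cong) auto
qed

lemma higher_fps_deriv_nth:
  "fps_nth ((fps_deriv ^^ m) F) k = of_nat (((k + m) choose m) * fact m) * fps_nth (F :: complex fps) (k + m)"
proof (induction m arbitrary: k)
  case (Suc m)
  have "(k + 1) * (((k + 1 + m) choose m) * fact m) = ((k + Suc m) choose Suc m) * fact (Suc m)"
  proof -
    have "Suc m * ((k + Suc m) choose Suc m) = (k + 1) * ((k + Suc m) choose m)"
      using binomial_absorb_comp[of "k + Suc m" m] Suc_times_binomial_eq[of "k + m" m]
      by (simp add: binomial_absorption mult.commute)
    then have "(k + 1) * ((k + Suc m) choose m) * fact m = Suc m * ((k + Suc m) choose Suc m) * fact m"
      by (simp only:)
    then show ?thesis unfolding fact_Suc of_nat_id by (simp only: ac_simps add_Suc_right add_Suc plus_1_eq_Suc)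
  qed
  then have eq: "of_nat (k + 1) * of_nat (((k + 1 + m) choose m) * fact m) =
      (of_nat (((k + Suc m) choose Suc m) * fact (Suc m)) :: complex)"
    by (simp only: of_nat_mult[symmetric])
  have "fps_nth ((fps_deriv ^^ Suc m) F) k = of_nat (k + 1) * (of_nat (((k + 1 + m) choose m) * fact m) * fps_nth F (k + 1 + m))"
    using Suc.IH[of "k + 1"] by simp
  also have "\<dots> = of_nat (((k + Suc m) choose Suc m) * fact (Suc m)) * fps_nth F (k + Suc m)"
    unfolding mult.assoc[symmetric] eq by simp
  finally show ?case .
qed simp

lemma taylor_coeff_eval_fps_sums:
  assumes "fps_conv_radius F = \<infinity>"
  shows "(\<lambda>k. fps_nth F k * (of_nat (k choose m) * z ^ (k - m))) sums taylor_coeff (eval_fps F) z m"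
proof -
  have rad: "fps_conv_radius ((fps_deriv ^^ m) F) = \<infinity>" for m
  proof (induction m)
    case (Suc m)
    then show ?case using fps_conv_radius_deriv[of "(fps_deriv ^^ m) F"] by simp
  qed (simp add: assms)
  have "(deriv ^^ m) (eval_fps F) = eval_fps ((fps_deriv ^^ m) F)" for m
  proof (induction m)
    case (Suc m)
    then show ?case using eval_fps_deriv[of _ "(fps_deriv ^^ m) F"] rad[of m] by auto
  qed simp
  then have "taylor_coeff (eval_fps F) z m = eval_fps ((fps_deriv ^^ m) F) z / fact m"
    by (simp add: taylor_coeff_def)
  moreover have "(\<lambda>k. fps_nth ((fps_deriv ^^ m) F) k * z ^ k) sums eval_fps ((fps_deriv ^^ m) F) z"
    using rad by (intro sums_eval_fps) auto
  ultimately have "(\<lambda>k. fps_nth ((fps_deriv ^^ m) F) k * z ^ k / fact m) sums taylor_coeff (eval_fps F) z m"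
    by (simp add: sums_divide)
  then have "(\<lambda>k. fps_nth F (k + m) * (of_nat ((k + m) choose m) * z ^ (k + m - m))) sums taylor_coeff (eval_fps F) z m"
    unfolding higher_fps_deriv_nth by (simp add: mult_ac)
  then show ?thesis
    by (subst (asm) sums_zero_iff_shift) (auto simp: binomial_eq_0)
qed

text \<open>
  Quantifying over these families lets one statement about positions in a block diagonal matrix
  serve all matrix functions that share the same block structure.
\<close>
definition sized_blocks :: "('a \<Rightarrow> nat) \<Rightarrow> 'a list \<Rightarrow> ('a \<Rightarrow> complex mat) set" where
  "sized_blocks d L = {F. \<forall>x\<in>set L. F x \<in> carrier_mat (d x) (d x)}"

lemma diag_block_mat_carrier:
  "F \<in> sized_blocks d L \<Longrightarrow> diag_block_mat (map F L) \<in> carrier_mat (sum_list (map d L)) (sum_list (map d L))"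
  by (intro carrier_matI) (auto simp: sized_blocks_def dim_diag_block_mat o_def intro!: arg_cong[where f = sum_list] map_cong)

lemma diag_block_mat_Cons_entry:
  assumes F: "F \<in> sized_blocks d (x # L)" and ij: "i < d x + sum_list (map d L)" "j < d x + sum_list (map d L)"
  shows "diag_block_mat (map F (x # L)) $$ (i, j) =
      (if i < d x then if j < d x then F x $$ (i, j) else 0
       else if j < d x then 0 else diag_block_mat (map F L) $$ (i - d x, j - d x))"
proof -
  have "F \<in> sized_blocks d L" "F x \<in> carrier_mat (d x) (d x)" using F by (auto simp: sized_blocks_def)
  then show ?thesis using ij diag_block_mat_carrier[of F d L] by (auto simp: Let_def)
qed

text \<open>
  The position \<open>(i, j)\<close> alone decides whether an entry lies off the blocks and, if not, which entry of
  which block it is. Thus estimates, limits and measurability of the whole matrix reduce to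
  entries of single blocks, uniformly in the family \<open>F\<close>.
\<close>
lemma diag_block_mat_entry:
  assumes "i < sum_list (map d L)" "j < sum_list (map d L)"
  shows "(\<forall>F\<in>sized_blocks d L. diag_block_mat (map F L) $$ (i, j) = 0) \<or>
    (\<exists>x i' j'. x \<in> set L \<and> i' < d x \<and> j' < d x \<and>
      (\<forall>F\<in>sized_blocks d L. diag_block_mat (map F L) $$ (i, j) = F x $$ (i', j')))"
  using assms
proof (induction L arbitrary: i j)
  case (Cons x L)
  let ?n = "d x" and ?m = "sum_list (map d L)"
  have entry: "diag_block_mat (map F (x # L)) $$ (i, j) =
      (if i < ?n then if j < ?n then F x $$ (i, j) else 0
       else if j < ?n then 0 else diag_block_mat (map F L) $$ (i - ?n, j - ?n))" if "F \<in> sized_blocks d (x # L)" for F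
    using Cons.prems by (intro diag_block_mat_Cons_entry that) auto
  consider (block) "i < ?n" "j < ?n" | (off) "(i < ?n) \<noteq> (j < ?n)" | (rest) "\<not> i < ?n" "\<not> j < ?n" by blast
  then show ?case
  proof cases
    case block
    then have "\<forall>F\<in>sized_blocks d (x # L). diag_block_mat (map F (x # L)) $$ (i, j) = F x $$ (i, j)"
      using entry by simp
    with block show ?thesis by (intro disjI2 exI[of _ x] exI[of _ i] exI[of _ j] conjI) simp_all
  next
    case off
    then have "\<forall>F\<in>sized_blocks d (x # L). diag_block_mat (map F (x # L)) $$ (i, j) = 0"
      using entry by auto
    then show ?thesis by (rule disjI1)
  next
    case rest
    then have step: "diag_block_mat (map F (x # L)) $$ (i, j) = diag_block_mat (map F L) $$ (i - ?n, j - ?n)"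
      if "F \<in> sized_blocks d (x # L)" for F
      using entry[OF that] by simp
    have sub: "F \<in> sized_blocks d L" if "F \<in> sized_blocks d (x # L)" for F
      using that by (simp add: sized_blocks_def)
    have "i - ?n < ?m" "j - ?n < ?m" using Cons.prems rest by auto
    note IH = Cons.IH[OF this]
    show ?thesis
    proof (rule disjE[OF IH])
      assume "\<forall>F\<in>sized_blocks d L. diag_block_mat (map F L) $$ (i - ?n, j - ?n) = 0"
      then have "\<forall>F\<in>sized_blocks d (x # L). diag_block_mat (map F (x # L)) $$ (i, j) = 0"
        unfolding Ball_def using step sub by presburger
      then show ?thesis by (rule disjI1)
    next
      assume "\<exists>y i' j'. y \<in> set L \<and> i' < d y \<and> j' < d y \<and>
        (\<forall>F\<in>sized_blocks d L. diag_block_mat (map F L) $$ (i - ?n, j - ?n) = F y $$ (i', j'))"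
      then obtain y i' j' where y: "y \<in> set L" "i' < d y" "j' < d y"
        and eq: "\<forall>F\<in>sized_blocks d L. diag_block_mat (map F L) $$ (i - ?n, j - ?n) = F y $$ (i', j')"
        by (elim exE conjE) (rule that)
      have "\<forall>F\<in>sized_blocks d (x # L). diag_block_mat (map F (x # L)) $$ (i, j) = F y $$ (i', j')"
        using step sub eq by simp
      then show ?thesis using y by (intro disjI2 exI[of _ y] exI[of _ i'] exI[of _ j'] conjI) simp_all
    qed
  qed
qed simp

lemma diag_block_mat_mult:
  assumes "F \<in> sized_blocks d L" "G \<in> sized_blocks d L"
  shows "diag_block_mat (map F L) * diag_block_mat (map G L) = diag_block_mat (map (\<lambda>x. F x * G x) L)"
  using assms
proof (induction L)
  case (Cons x L)
  let ?n = "d x" and ?m = "sum_list (map d L)"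
  have sub: "F \<in> sized_blocks d L" "G \<in> sized_blocks d L" "(\<lambda>x. F x * G x) \<in> sized_blocks d L"
    using Cons.prems by (auto simp: sized_blocks_def)
  have c: "F x \<in> carrier_mat ?n ?n" "G x \<in> carrier_mat ?n ?n"
    "diag_block_mat (map F L) \<in> carrier_mat ?m ?m" "diag_block_mat (map G L) \<in> carrier_mat ?m ?m"
    "diag_block_mat (map (\<lambda>x. F x * G x) L) \<in> carrier_mat ?m ?m"
    using Cons.prems sub by (auto simp: sized_blocks_def intro: diag_block_mat_carrier)
  have "diag_block_mat (map F (x # L)) * diag_block_mat (map G (x # L)) =
     four_block_mat (F x) (0\<^sub>m ?n ?m) (0\<^sub>m ?m ?n) (diag_block_mat (map F L)) *
     four_block_mat (G x) (0\<^sub>m ?n ?m) (0\<^sub>m ?m ?n) (diag_block_mat (map G L))"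
    using c by (simp add: Let_def)
  also have "\<dots> = four_block_mat (F x * G x) (0\<^sub>m ?n ?m) (0\<^sub>m ?m ?n) (diag_block_mat (map F L) * diag_block_mat (map G L))"
    using c by (subst mult_four_block_mat[OF c(1) _ _ c(3) c(2) _ _ c(4)]) auto
  also have "diag_block_mat (map F L) * diag_block_mat (map G L) = diag_block_mat (map (\<lambda>x. F x * G x) L)"
    using Cons.IH sub by simp
  finally have eq: "diag_block_mat (map F (x # L)) * diag_block_mat (map G (x # L)) =
     four_block_mat (F x * G x) (0\<^sub>m ?n ?m) (0\<^sub>m ?m ?n) (diag_block_mat (map (\<lambda>x. F x * G x) L))" .
  then show ?case
    unfolding eq using c carrier_matD[OF c(1)] carrier_matD[OF c(2)] by (simp add: Let_def)
qed simp

lemma toeplitz_carrier [simp]: "toeplitz n a \<in> carrier_mat n n"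
  by (simp add: toeplitz_def)

lemma toeplitz_entry: "i < n \<Longrightarrow> j < n \<Longrightarrow> toeplitz n a $$ (i, j) = (if i \<le> j then a (j - i) else 0)"
  by (simp add: toeplitz_def)

text \<open>
  Toeplitz matrices multiply like truncated power series. Together with the Leibniz rule for Taylor
  coefficients this makes the functional calculus multiplicative.
\<close>
lemma toeplitz_mult: "toeplitz n a * toeplitz n b = toeplitz n (\<lambda>m. \<Sum>i\<le>m. a i * b (m - i))"
proof (rule eq_matI)
  fix i j assume "i < dim_row (toeplitz n (\<lambda>m. \<Sum>i\<le>m. a i * b (m - i)))" "j < dim_col (toeplitz n (\<lambda>m. \<Sum>i\<le>m. a i * b (m - i)))"
  then have ij: "i < n" "j < n" by (auto simp: toeplitz_def)
  have "(toeplitz n a * toeplitz n b) $$ (i, j) = (\<Sum>k\<in>{0..<n}. (if i \<le> k then a (k - i) else 0) * (if k \<le> j then b (j - k) else 0))"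
    using ij by (auto simp: toeplitz_def scalar_prod_def intro!: sum.cong)
  also have "\<dots> = (\<Sum>k\<in>{i..j}. a (k - i) * b (j - k))"
    using ij by (intro sum.mono_neutral_cong_right) auto
  also have "\<dots> = (if i \<le> j then \<Sum>k\<le>j - i. a k * b (j - i - k) else 0)"
    by (auto intro!: sum.reindex_bij_witness[of _ "\<lambda>k. k + i" "\<lambda>k. k - i"])
  finally show "(toeplitz n a * toeplitz n b) $$ (i, j) = toeplitz n (\<lambda>m. \<Sum>i\<le>m. a i * b (m - i)) $$ (i, j)"
    using ij by (simp add: toeplitz_def)
qed (auto simp: toeplitz_def)

lemma jordan_block_pow_toeplitz:
  "jordan_block n z ^\<^sub>m k = toeplitz n (\<lambda>m. of_nat (k choose m) * z ^ (k - m))"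
  by (rule eq_matI) (auto simp: toeplitz_def jordan_block_pow binomial_eq_0 intro!: arg_cong[where f = "power z"])

lemma norm_matrix_vector_mult_le:
  fixes M :: "complex ^ 'n ^ 'n::finite"
  assumes "\<And>i j. norm ((M $ i) $ j) \<le> b"
  shows "norm (M *v x) \<le> real CARD('n) ^ 2 * b * norm x"
proof -
  have b: "b \<ge> 0" using assms norm_ge_zero order_trans by blast
  have "norm (M *v x) \<le> (\<Sum>i\<in>UNIV. norm ((M *v x) $ i))"
    unfolding norm_vec_def[of "M *v x"] by (rule L2_set_le_sum) simp
  also have "\<dots> \<le> (\<Sum>i\<in>(UNIV::'n set). \<Sum>j\<in>(UNIV::'n set). b * norm x)"
  proof (rule sum_mono)
    fix i
    have "norm ((M *v x) $ i) \<le> (\<Sum>j\<in>UNIV. norm ((M $ i) $ j * x $ j))"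
      by (simp add: matrix_vector_mult_def norm_sum)
    also have "\<dots> \<le> (\<Sum>j\<in>(UNIV::'n set). b * norm x)"
      unfolding norm_mult by (intro sum_mono mult_mono assms b) (auto simp: Finite_Cartesian_Product.norm_nth_le)
    finally show "norm ((M *v x) $ i) \<le> (\<Sum>j\<in>(UNIV::'n set). b * norm x)" .
  qed
  finally show ?thesis by (simp add: power2_eq_square mult_ac)
qed

lemma to_cart_mult:
  fixes ix :: "'n::finite \<Rightarrow> nat"
  assumes ix: "bij_betw ix UNIV {..<CARD('n)}"
    and M: "M \<in> carrier_mat CARD('n) CARD('n)" "N \<in> carrier_mat CARD('n) CARD('n)"
  shows "to_cart ix (M * N) = to_cart ix M ** to_cart ix N"
proof -
  have lt: "ix i < CARD('n)" for i using ix by (auto simp: bij_betw_def)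
  have "(M * N) $$ (ix i, ix j) = (\<Sum>k\<in>UNIV. M $$ (ix i, ix k) * N $$ (ix k, ix j))" for i j
  proof -
    have "(M * N) $$ (ix i, ix j) = (\<Sum>k\<in>{..<CARD('n)}. M $$ (ix i, k) * N $$ (k, ix j))"
      using M lt[of i] lt[of j] by (auto simp: scalar_prod_def lessThan_atLeast0 intro!: sum.cong)
    also have "\<dots> = (\<Sum>k\<in>UNIV. M $$ (ix i, ix k) * N $$ (ix k, ix j))"
      by (rule sum.reindex_bij_betw[OF ix, symmetric])
    finally show ?thesis .
  qed
  then show ?thesis by (simp add: to_cart_def matrix_matrix_mult_def Finite_Cartesian_Product.vec_eq_iff)
qed

lemma to_cart_one:
  fixes ix :: "'n::finite \<Rightarrow> nat"
  assumes ix: "bij_betw ix UNIV {..<CARD('n)}"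
  shows "to_cart ix (1\<^sub>m CARD('n)) = (Finite_Cartesian_Product.mat 1 :: complex ^ 'n ^ 'n)"
proof -
  have "ix i < CARD('n)" "ix i = ix j \<longleftrightarrow> i = j" for i j using ix by (auto simp: bij_betw_def inj_on_def)
  then show ?thesis by (simp add: to_cart_def Finite_Cartesian_Product.mat_def Finite_Cartesian_Product.vec_eq_iff)
qed

lemma matpow_scaleR: "matpow (c *\<^sub>R M) k = c ^ k *\<^sub>R matpow M k"
proof (induction k)
  case (Suc k)
  then show ?case
    by (simp add: matpow_def matrix_scalar_ac scalar_matrix_assoc[symmetric])
qed (simp add: matpow_def)

lemma matpow_to_cart:
  fixes ix :: "'n::finite \<Rightarrow> nat"
  assumes ix: "bij_betw ix UNIV {..<CARD('n)}" and M: "M \<in> carrier_mat CARD('n) CARD('n)"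
  shows "matpow (to_cart ix M) k = to_cart ix (M ^\<^sub>m k)"
proof (induction k)
  case 0
  then show ?case using M to_cart_one[OF ix] by (simp add: matpow_def)
next
  case (Suc k)
  have comm: "M * M ^\<^sub>m k = M ^\<^sub>m k * M"
  proof (induction k)
    case (Suc k)
    have "M * (M ^\<^sub>m k * M) = (M * M ^\<^sub>m k) * M"
      using M by (intro assoc_mult_mat[symmetric]) (auto intro!: pow_carrier_mat)
    then show ?case using Suc by simp
  qed (use M in auto)
  have "matpow (to_cart ix M) (Suc k) = to_cart ix M ** to_cart ix (M ^\<^sub>m k)"
    using Suc by (simp add: matpow_def)
  also have "\<dots> = to_cart ix (M * M ^\<^sub>m k)"
    using M by (intro to_cart_mult[OF ix, symmetric]) (auto intro!: pow_carrier_mat)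
  finally show ?case by (simp add: comm)
qed

section \<open>Holomorphic functional calculus on the unstable blocks\<close>

text \<open>
  The index type \<open>'n\<close> carries the whole block structure: stable blocks \<open>ss\<close> first, then unstable
  blocks \<open>us\<close>.
\<close>
locale jordan_blocks =
  fixes ix :: "'n::finite \<Rightarrow> nat" and ss us :: "(nat \<times> complex) list"
  assumes ix: "bij_betw ix UNIV {..<CARD('n)}"
    and dim: "sum_list (map fst (ss @ us)) = CARD('n)"
begin

text \<open>
  The tag separates the two kinds of blocks, so that matrices vanishing on the stable blocks are given by
  one function on a single list.
\<close>
definition tagged :: "(bool \<times> nat \<times> complex) list" where
  "tagged = map (Pair False) ss @ map (Pair True) us"

definition block_mat :: "(bool \<times> nat \<times> complex \<Rightarrow> complex mat) \<Rightarrow> complex ^ 'n ^ 'n" where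
  "block_mat F = to_cart ix (diag_block_mat (map F tagged))"

definition sized :: "(bool \<times> nat \<times> complex \<Rightarrow> complex mat) set" where
  "sized = sized_blocks (\<lambda>(b, n, z). n) tagged"

text \<open>
  The holomorphic functional calculus \<open>f(A) \<pi>\<^sub>u\<close>: zero on the stable blocks and \<open>f\<close> of the Jordan block
  on the unstable ones.
\<close>
definition unstable_fun :: "(complex \<Rightarrow> complex) \<Rightarrow> complex ^ 'n ^ 'n" where
  "unstable_fun f = unstable_blocks ix ss us (\<lambda>n z. toeplitz n (taylor_coeff f z))"

lemma sum_tagged: "sum_list (map (\<lambda>(b, n, z). n) tagged) = CARD('n)"
  using dim by (simp add: tagged_def o_def case_prod_unfold)

lemma diag_tagged_carrier: "F \<in> sized \<Longrightarrow> diag_block_mat (map F tagged) \<in> carrier_mat CARD('n) CARD('n)"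
  unfolding sum_tagged[symmetric] sized_def by (rule diag_block_mat_carrier)

lemma block_mat_mult:
  assumes "F \<in> sized" "G \<in> sized"
  shows "block_mat F ** block_mat G = block_mat (\<lambda>x. F x * G x)"
  unfolding block_mat_def to_cart_mult[OF ix diag_tagged_carrier[OF assms(1)] diag_tagged_carrier[OF assms(2)], symmetric]
  by (rule arg_cong[OF diag_block_mat_mult[OF assms[unfolded sized_def]]])

lemma block_mat_cong: "(\<And>x. x \<in> set tagged \<Longrightarrow> F x = G x) \<Longrightarrow> block_mat F = block_mat G"
  unfolding block_mat_def by (intro arg_cong[where f = "\<lambda>L. to_cart ix (diag_block_mat L)"] map_cong refl)

lemma block_mat_entry:
  "(\<forall>F\<in>sized. (block_mat F $ i) $ j = 0) \<or>
   (\<exists>b n z i' j'. (b, n, z) \<in> set tagged \<and> i' < n \<and> j' < n \<and>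
     (\<forall>F\<in>sized. (block_mat F $ i) $ j = F (b, n, z) $$ (i', j')))"
proof -
  have "ix k < CARD('n)" for k using ix by (auto simp: bij_betw_def)
  then show ?thesis
    using diag_block_mat_entry[of "ix i" "\<lambda>(b, n, z). n" tagged "ix j"]
    unfolding sum_tagged by (simp add: block_mat_def to_cart_def sized_def)
qed

lemma unstable_blocks_eq:
  "unstable_blocks ix ss us F = block_mat (\<lambda>(b, n, z). if b then F n z else 0\<^sub>m n n)"
  unfolding unstable_blocks_def block_mat_def tagged_def
  by (intro arg_cong[where f = "to_cart ix"] arg_cong[where f = diag_block_mat]) (auto simp: o_def)

lemma sized_unstable:
  "(\<And>n z. (n, z) \<in> set us \<Longrightarrow> F n z \<in> carrier_mat n n) \<Longrightarrow> (\<lambda>(b, n, z). if b then F n z else 0\<^sub>m n n) \<in> sized"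
  unfolding sized_def sized_blocks_def tagged_def by auto

lemma unstable_fun_entry:
  "(\<forall>f. (unstable_fun f $ i) $ j = 0) \<or>
   (\<exists>n z m. (n, z) \<in> set us \<and> m < n \<and> (\<forall>f. (unstable_fun f $ i) $ j = taylor_coeff f z m))"
proof -
  let ?F = "\<lambda>f. (\<lambda>(b, n, z). if b then toeplitz n (taylor_coeff f z) else 0\<^sub>m n n)"
  have sz: "?F f \<in> sized" for f by (rule sized_unstable) simp
  have eq: "unstable_fun f = block_mat (?F f)" for f
    unfolding unstable_fun_def unstable_blocks_eq ..
  show ?thesis
  proof (rule disjE[OF block_mat_entry[of i j]])
    assume zero: "\<forall>F\<in>sized. (block_mat F $ i) $ j = 0"
    have "\<forall>f. (unstable_fun f $ i) $ j = 0"
      unfolding eq by (intro allI bspec[OF zero] sz)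
    then show ?thesis by (rule disjI1)
  next
    assume "\<exists>b n z i' j'. (b, n, z) \<in> set tagged \<and> i' < n \<and> j' < n \<and>
      (\<forall>F\<in>sized. (block_mat F $ i) $ j = F (b, n, z) $$ (i', j'))"
    then obtain b n z i' j' where x: "(b, n, z) \<in> set tagged" "i' < n" "j' < n"
      and e: "\<forall>F\<in>sized. (block_mat F $ i) $ j = F (b, n, z) $$ (i', j')" by (elim exE conjE) (rule that)
    have e': "(unstable_fun f $ i) $ j = (if b \<and> i' \<le> j' then taylor_coeff f z (j' - i') else 0)" for f
      unfolding eq bspec[OF e sz] using x by (auto simp: toeplitz_entry)
    show ?thesis
    proof (cases "b \<and> i' \<le> j'")
      case True
      then have "(n, z) \<in> set us" "j' - i' < n" using x by (auto simp: tagged_def)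
      then show ?thesis using e' True by (intro disjI2 exI[of _ n] exI[of _ z] exI[of _ "j' - i'"]) simp
    next
      case False
      then show ?thesis using e' by (intro disjI1) auto
    qed
  qed
qed

lemma unstable_fun_mult:
  assumes "open S" "f holomorphic_on S" "g holomorphic_on S" "\<And>n z. (n, z) \<in> set us \<Longrightarrow> z \<in> S"
  shows "unstable_fun f ** unstable_fun g = unstable_fun (\<lambda>w. f w * g w)"
proof -
  have coeff: "taylor_coeff (\<lambda>w. f w * g w) z = (\<lambda>m. \<Sum>i\<le>m. taylor_coeff f z i * taylor_coeff g z (m - i))"
    if "(n, z) \<in> set us" for n z
    using taylor_coeff_mult[OF assms(1-3) assms(4)[OF that]] by (rule ext)
  show ?thesis
    unfolding unstable_fun_def unstable_blocks_eq
  proof (subst block_mat_mult)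
    show "block_mat (\<lambda>x. (case x of (b, n, z) \<Rightarrow> if b then toeplitz n (taylor_coeff f z) else 0\<^sub>m n n) *
        (case x of (b, n, z) \<Rightarrow> if b then toeplitz n (taylor_coeff g z) else 0\<^sub>m n n)) =
      block_mat (\<lambda>(b, n, z). if b then toeplitz n (taylor_coeff (\<lambda>w. f w * g w) z) else 0\<^sub>m n n)"
      using coeff by (intro block_mat_cong) (auto simp: tagged_def toeplitz_mult)
  qed (rule sized_unstable, simp)+
qed

lemma unstable_fun_cong:
  assumes "open S" "f holomorphic_on S" "\<And>w. w \<in> S \<Longrightarrow> f w = g w" "\<And>n z. (n, z) \<in> set us \<Longrightarrow> z \<in> S"
  shows "unstable_fun f = unstable_fun g"
proof -
  have "g holomorphic_on S" using assms(2,3) by (metis holomorphic_transform)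
  then have c: "taylor_coeff f z m = taylor_coeff g z m" if "(n, z) \<in> set us" for n z m
    unfolding taylor_coeff_def
    using higher_deriv_transform_within_open[OF assms(2) _ assms(1,4) assms(3)] that by metis
  have "(unstable_fun f $ i) $ j = (unstable_fun g $ i) $ j" for i j
    by (rule disjE[OF unstable_fun_entry[of i j]]) (auto simp: c)
  then show ?thesis by (simp add: Finite_Cartesian_Product.vec_eq_iff)
qed

lemma unstable_fun_diff:
  assumes "open S" "f holomorphic_on S" "g holomorphic_on S" "\<And>n z. (n, z) \<in> set us \<Longrightarrow> z \<in> S"
  shows "unstable_fun f - unstable_fun g = unstable_fun (\<lambda>w. f w - g w)"
proof -
  have c: "taylor_coeff (\<lambda>w. f w - g w) z m = taylor_coeff f z m - taylor_coeff g z m" if "(n, z) \<in> set us" for n z m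
    unfolding taylor_coeff_def higher_deriv_diff[OF assms(2,3,1) assms(4)[OF that]] by (rule diff_divide_distrib)
  have "(unstable_fun f $ i) $ j - (unstable_fun g $ i) $ j = (unstable_fun (\<lambda>w. f w - g w) $ i) $ j" for i j
    by (rule disjE[OF unstable_fun_entry[of i j]]) (auto simp: c)
  then show ?thesis by (simp add: Finite_Cartesian_Product.vec_eq_iff)
qed

lemma unstable_fun_scaleR:
  assumes "open S" "f holomorphic_on S" "\<And>n z. (n, z) \<in> set us \<Longrightarrow> z \<in> S"
  shows "c *\<^sub>R unstable_fun f = unstable_fun (\<lambda>w. of_real c * f w)"
proof -
  have coeff: "taylor_coeff (\<lambda>w. of_real c * f w) z m = c *\<^sub>R taylor_coeff f z m" if "(n, z) \<in> set us" for n z m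
    unfolding taylor_coeff_def higher_deriv_cmult[OF assms(2) assms(3)[OF that] assms(1)] by (simp add: scaleR_conv_of_real)
  have "c *\<^sub>R (unstable_fun f $ i) $ j = (unstable_fun (\<lambda>w. of_real c * f w) $ i) $ j" for i j
    by (rule disjE[OF unstable_fun_entry[of i j]]) (auto simp: coeff)
  then show ?thesis by (simp add: Finite_Cartesian_Product.vec_eq_iff)
qed

lemma unstable_fun_one: "unstable_blocks ix ss us (\<lambda>n _. 1\<^sub>m n) = unstable_fun (\<lambda>_. 1)"
proof -
  have "1\<^sub>m n = toeplitz n (taylor_coeff (\<lambda>_. 1) z)" for n z
    by (rule eq_matI) (auto simp: toeplitz_def taylor_coeff_def)
  then show ?thesis unfolding unstable_fun_def by (intro arg_cong[where f = "unstable_blocks ix ss us"] ext)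
qed

text \<open>
  By Cauchy's inequality, the Taylor coefficient of index \<open>m\<close> is at most \<open>M / r\<^bsup>m\<^esup>\<close>. As \<open>r \<le> 1\<close>, the
  exponent can be raised to the dimension, which makes the constant independent of \<open>f\<close>.
\<close>
lemma norm_unstable_fun_le:
  assumes "open S" "f holomorphic_on S" "0 < r" "r \<le> 1" "\<And>n z. (n, z) \<in> set us \<Longrightarrow> cball z r \<subseteq> S"
    and "M \<ge> 0" "\<And>n z w. (n, z) \<in> set us \<Longrightarrow> w \<in> cball z r \<Longrightarrow> norm (f w) \<le> M"
  shows "norm (unstable_fun f *v x) \<le> real CARD('n) ^ 2 / r ^ CARD('n) * M * norm x"
proof -
  have le: "norm (taylor_coeff f z m) \<le> M / r ^ CARD('n)" if z: "(n, z) \<in> set us" "m < n" for n z m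
  proof -
    have "n \<le> CARD('n)"
      using z(1) member_le_sum_list[of n "map fst (ss @ us)"] dim by force
    have "norm ((deriv ^^ m) f z) \<le> fact m * M / r ^ m"
    proof (rule Cauchy_inequality)
      show "f holomorphic_on ball z r"
        using assms(5)[OF z(1)] ball_subset_cball[of z r] by (intro holomorphic_on_subset[OF assms(2)]) blast
      show "continuous_on (cball z r) f"
        by (intro continuous_on_subset[OF holomorphic_on_imp_continuous_on[OF assms(2)]] assms(5)[OF z(1)])
      show "norm (f w) \<le> M" if "norm (z - w) = r" for w
        using that assms(7)[OF z(1), of w] by (simp add: dist_norm)
    qed fact
    then have "norm (taylor_coeff f z m) \<le> M / r ^ m"
      by (simp add: taylor_coeff_def norm_divide field_simps)
    also have "\<dots> \<le> M / r ^ CARD('n)"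
      using assms z \<open>n \<le> CARD('n)\<close> by (intro divide_left_mono power_decreasing mult_pos_pos zero_less_power) auto
    finally show ?thesis .
  qed
  have "norm ((unstable_fun f $ i) $ j) \<le> M / r ^ CARD('n)" for i j
  proof -
    have "0 \<le> M / r ^ CARD('n)" using assms by simp
    with le have le': "0 \<le> M / r ^ CARD('n)"
      "(n, z) \<in> set us \<and> m < n \<Longrightarrow> norm (taylor_coeff f z m) \<le> M / r ^ CARD('n)" for n z m
      by blast+
    show ?thesis
      by (rule disjE[OF unstable_fun_entry[of i j]]) (use le' in \<open>auto\<close>)
  qed
  from norm_matrix_vector_mult_le[of "unstable_fun f", OF this, of x] show ?thesis by simp
qed

text \<open>
  The matrix power series is summed entry by entry: the powers of a Jordan block are Toeplitz with
  entries \<open>(k choose m) z\<^bsup>k-m\<^esup>\<close>, and the resulting series is the Taylor coefficient of the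
  scalar function.
\<close>
lemma mittag_leffler_mat_unstable:
  assumes rad: "fps_conv_radius (ml_fps p \<beta>) = \<infinity>"
  shows "mittag_leffler_mat p \<beta> (c *\<^sub>R A_mat ix ss us) ** unstable_fun (\<lambda>_. 1) =
    unstable_fun (\<lambda>w. mittag_leffler p \<beta> (of_real c * w))"
proof -
  define T where "T k = (\<lambda>(b :: bool, n, z). toeplitz n (\<lambda>m. of_nat (k choose m) * z ^ (k - m)))" for k
  define E where "E = (\<lambda>(b :: bool, n, z). toeplitz n (taylor_coeff (\<lambda>w. mittag_leffler p \<beta> (of_real c * w)) z))"
  have sz: "T k \<in> sized" "E \<in> sized" for k by (auto simp: T_def E_def sized_def sized_blocks_def)
  have A: "A_mat ix ss us = to_cart ix (jordan_matrix (ss @ us))" by (rule A_mat_def)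
  have J: "jordan_matrix (ss @ us) ^\<^sub>m k = diag_block_mat (map (T k) tagged)" for k
    unfolding jordan_matrix_pow tagged_def
    by (intro arg_cong[where f = diag_block_mat]) (auto simp: T_def jordan_block_pow_toeplitz)
  have "jordan_matrix (ss @ us) \<in> carrier_mat CARD('n) CARD('n)"
    using dim by (intro carrier_matI) simp_all
  then have pow: "matpow (c *\<^sub>R A_mat ix ss us) k = c ^ k *\<^sub>R block_mat (T k)" for k
    unfolding matpow_scaleR A by (simp add: matpow_to_cart[OF ix] J block_mat_def)
  have coeff: "(\<lambda>k. (1 / Gamma (p * real k + \<beta>)) *\<^sub>R (c ^ k *\<^sub>R (of_nat (k choose m) * z ^ (k - m)))) sums
      taylor_coeff (\<lambda>w. mittag_leffler p \<beta> (of_real c * w)) z m" for z m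
  proof -
    have holo: "mittag_leffler p \<beta> holomorphic_on UNIV"
      unfolding mittag_leffler_def using rad by (intro holomorphic_on_eval_fps) auto
    have "(deriv ^^ m) (\<lambda>w. mittag_leffler p \<beta> (of_real c * w)) z =
        of_real c ^ m * (deriv ^^ m) (mittag_leffler p \<beta>) (of_real c * z)"
      by (rule higher_deriv_compose_linear[OF holo, of UNIV]) auto
    then have eq: "taylor_coeff (\<lambda>w. mittag_leffler p \<beta> (of_real c * w)) z m =
        of_real c ^ m * taylor_coeff (mittag_leffler p \<beta>) (of_real c * z) m"
      by (simp add: taylor_coeff_def)
    have "(\<lambda>k. fps_nth (ml_fps p \<beta>) k * (of_nat (k choose m) * (of_real c * z) ^ (k - m))) sums
        taylor_coeff (mittag_leffler p \<beta>) (of_real c * z) m"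
      unfolding mittag_leffler_def by (rule taylor_coeff_eval_fps_sums[OF rad])
    then have "(\<lambda>k. of_real c ^ m * (fps_nth (ml_fps p \<beta>) k * (of_nat (k choose m) * (of_real c * z) ^ (k - m)))) sums
        taylor_coeff (\<lambda>w. mittag_leffler p \<beta> (of_real c * w)) z m"
      unfolding eq by (rule sums_mult)
    moreover have "of_real c ^ m * (fps_nth (ml_fps p \<beta>) k * (of_nat (k choose m) * (of_real c * z) ^ (k - m))) =
      (1 / Gamma (p * real k + \<beta>)) *\<^sub>R (c ^ k *\<^sub>R (of_nat (k choose m) * z ^ (k - m)))" for k
    proof (cases "m \<le> k")
      case True
      then have "complex_of_real c ^ k = of_real c ^ m * of_real c ^ (k - m)"
        by (simp flip: power_add)
      then show ?thesis
        by (simp add: ml_fps_def scaleR_conv_of_real power_mult_distrib)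
    qed (simp add: binomial_eq_0)
    ultimately show ?thesis by simp
  qed
  have "(\<lambda>k. (1 / Gamma (p * real k + \<beta>)) *\<^sub>R matpow (c *\<^sub>R A_mat ix ss us) k) sums block_mat E"
    unfolding sums_def
  proof (intro vec_tendstoI)
    fix i j
    have "(\<lambda>k. (((1 / Gamma (p * real k + \<beta>)) *\<^sub>R matpow (c *\<^sub>R A_mat ix ss us) k) $ i) $ j) sums ((block_mat E $ i) $ j)"
    proof (rule disjE[OF block_mat_entry[of i j]])
      assume zero: "\<forall>F\<in>sized. (block_mat F $ i) $ j = 0"
      show ?thesis unfolding pow vector_scaleR_component bspec[OF zero sz(1)] bspec[OF zero sz(2)] by simp
    next
      assume "\<exists>b n z i' j'. (b, n, z) \<in> set tagged \<and> i' < n \<and> j' < n \<and>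
      (\<forall>F\<in>sized. (block_mat F $ i) $ j = F (b, n, z) $$ (i', j'))"
      then obtain b n z i' j' where x: "i' < n" "j' < n"
        and e: "\<forall>F\<in>sized. (block_mat F $ i) $ j = F (b, n, z) $$ (i', j')" by (elim exE conjE) (rule that)
      show ?thesis
        unfolding pow vector_scaleR_component e[rule_format, OF sz(1)] e[rule_format, OF sz(2)]
        using x coeff[where z = z and m = "j' - i'"] by (cases "i' \<le> j'") (simp_all add: T_def E_def toeplitz_entry)
    qed
    then show "(\<lambda>N. ((\<Sum>k<N. (1 / Gamma (p * real k + \<beta>)) *\<^sub>R matpow (c *\<^sub>R A_mat ix ss us) k) $ i) $ j)
        \<longlonglongrightarrow> (block_mat E $ i) $ j"
      by (simp add: sums_def sum_component)
  qed
  then have ml_eq: "mittag_leffler_mat p \<beta> (c *\<^sub>R A_mat ix ss us) = block_mat E"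
    unfolding mittag_leffler_mat_def by (simp add: sums_iff)
  have "block_mat E ** unstable_fun (\<lambda>_. 1) = block_mat E ** block_mat (\<lambda>(b, n, z). if b then 1\<^sub>m n else 0\<^sub>m n n)"
    unfolding unstable_fun_one[symmetric] unstable_blocks_eq ..
  also have "\<dots> = unstable_fun (\<lambda>w. mittag_leffler p \<beta> (of_real c * w))"
    unfolding unstable_fun_def unstable_blocks_eq
  proof (subst block_mat_mult)
    show "(\<lambda>(b, n, z). if b then 1\<^sub>m n else 0\<^sub>m n n) \<in> sized" by (rule sized_unstable) simp
    show "block_mat (\<lambda>x. E x * (case x of (b, n, z) \<Rightarrow> if b then 1\<^sub>m n else 0\<^sub>m n n)) =
      block_mat (\<lambda>(b, n, z). if b then toeplitz n (taylor_coeff (\<lambda>w. mittag_leffler p \<beta> (of_real c * w)) z) else 0\<^sub>m n n)"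
      by (rule block_mat_cong)
         (auto simp: E_def right_mult_one_mat[OF toeplitz_carrier] right_mult_zero_mat[OF toeplitz_carrier])
  qed (rule sz)
  finally show ?thesis unfolding ml_eq .
qed

end

section \<open>Dominating functions, measurability and compactness\<close>

text \<open>
  The dominating function of \<open>s = t - \<tau>\<close>: exponential decay for \<open>s \<le> 0\<close>, the integrable singularity of
  \<open>s\<^bsup>p-1\<^esup>\<close> at zero, and the integrable tail \<open>s\<^bsup>-1-p\<^esup>\<close>. Integrals in \<open>\<tau>\<close> of its reflections do not
  depend on \<open>t\<close>, which is where the uniformity in \<open>t\<close> comes from.
\<close>
definition envelope :: "real \<Rightarrow> real \<Rightarrow> real \<Rightarrow> real \<Rightarrow> real" where
  "envelope p c s0 s = (if s \<le> 0 then exp (c * s) else if s \<le> s0 then s powr (p - 1) else s powr (- 1 - p))"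

lemma envelope_nonneg: "0 \<le> envelope p c s0 s"
  by (simp add: envelope_def)

lemma envelope_measurable: "envelope p c s0 \<in> borel_measurable borel"
  unfolding envelope_def[abs_def] by measurable

lemma set_integrable_lborel_nonneg:
  fixes f :: "real \<Rightarrow> real"
  assumes "(f has_integral I) A" "\<And>x. x \<in> A \<Longrightarrow> 0 \<le> f x" "f \<in> borel_measurable borel" "A \<in> sets borel"
  shows "set_integrable lborel A f"
proof -
  have "set_integrable lebesgue A f"
    using assms(1,2) by (intro nonnegative_absolutely_integrable_1) (auto simp: has_integral_iff)
  then show ?thesis
    unfolding set_integrable_def using assms(3,4) by (subst (asm) integrable_completion) auto
qed

lemma integrable_envelope:
  assumes "0 < p" "c > 0" "s0 > 0"
  shows "integrable lborel (envelope p c s0)"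
proof -
  have "set_integrable lborel {0..} (\<lambda>x. exp (- c * x))"
    using assms by (intro set_integrable_lborel_nonneg[OF has_integral_exp_minus_to_infinity]) auto
  then have "integrable lborel (\<lambda>s. indicator {0..} (0 + (- 1) * s) *\<^sub>R exp (- c * (0 + (- 1) * s)))"
    unfolding set_integrable_def by (intro lborel_integrable_real_affine) auto
  moreover have "set_integrable lborel {0..s0} (\<lambda>s. s powr (p - 1))"
    using assms by (intro set_integrable_lborel_nonneg[OF has_integral_powr_from_0]) auto
  moreover have "set_integrable lborel {s0..} (\<lambda>s. s powr (- 1 - p))"
    using assms by (intro set_integrable_lborel_nonneg[OF has_integral_powr_to_inf]) auto
  ultimately have "integrable lborel (\<lambda>s. indicator {0..} (0 + (- 1) * s) *\<^sub>R exp (- c * (0 + (- 1) * s)) +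
     indicator {0..s0} s *\<^sub>R s powr (p - 1) + indicator {s0..} s *\<^sub>R s powr (- 1 - p))"
    unfolding set_integrable_def by (intro Bochner_Integration.integrable_add) auto
  then show ?thesis
    by (rule Bochner_Integration.integrable_bound)
       (auto simp: envelope_def indicator_def envelope_measurable)
qed

lemma integrable_envelope_reflect:
  assumes "0 < p" "c > 0" "s0 > 0"
  shows "integrable lborel (\<lambda>\<tau>. envelope p c s0 (t - \<tau>))"
    "(LINT \<tau>|lborel. envelope p c s0 (t - \<tau>)) = (LINT s|lborel. envelope p c s0 s)"
  using lborel_integrable_real_affine[OF integrable_envelope[OF assms], of "- 1" t]
    lborel_integral_real_affine[of "- 1" "envelope p c s0" t] by simp_all

text \<open>
  Each derivative is a pointwise limit of difference quotients of the preceding one, so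
  measurability in the parameter is inherited.
\<close>
lemma borel_measurable_taylor_coeff:
  assumes S: "open S" and holo: "\<And>\<tau>. f \<tau> holomorphic_on S"
    and meas: "\<And>w. w \<in> S \<Longrightarrow> (\<lambda>\<tau>. f \<tau> w) \<in> borel_measurable M" and z: "z \<in> S"
  shows "(\<lambda>\<tau>. taylor_coeff (f \<tau>) z m) \<in> borel_measurable M"
proof -
  have "(\<lambda>\<tau>. (deriv ^^ m) (f \<tau>) w) \<in> borel_measurable M" if "w \<in> S" for w
    using that
  proof (induction m arbitrary: w)
    case 0
    then show ?case using meas by simp
  next
    case (Suc m)
    obtain r where r: "r > 0" "cball w r \<subseteq> S" using S Suc.prems open_contains_cball by blast
    define h where "h n = complex_of_real (r / (real n + 1))" for n :: nat
    have h: "h n \<noteq> 0" "w + h n \<in> S" for n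
    proof -
      show "h n \<noteq> 0" using r by (simp add: h_def del: of_real_divide)
      have "norm (h n) \<le> r" unfolding h_def norm_of_real using r by (auto simp: field_simps)
      then show "w + h n \<in> S" using r by (intro subsetD[OF r(2)]) (simp add: dist_norm)
    qed
    have h0: "h \<longlonglongrightarrow> 0"
    proof -
      have "(\<lambda>n. r / (real n + 1)) \<longlonglongrightarrow> 0" by real_asymp
      then have "(\<lambda>n. complex_of_real (r / (real n + 1))) \<longlonglongrightarrow> of_real 0" by (rule tendsto_of_real)
      then show ?thesis by (simp add: h_def[abs_def] del: of_real_divide)
    qed
    show ?case
    proof (rule borel_measurable_LIMSEQ_metric)
      show "(\<lambda>\<tau>. ((deriv ^^ m) (f \<tau>) (w + h n) - (deriv ^^ m) (f \<tau>) w) / h n) \<in> borel_measurable M" for n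
        using Suc.IH[OF h(2)[of n]] Suc.IH[OF Suc.prems] by measurable
      fix \<tau>
      have "((deriv ^^ m) (f \<tau>) has_field_derivative (deriv ^^ Suc m) (f \<tau>) w) (at w)"
        using has_field_derivative_higher_deriv[OF holo S Suc.prems] by simp
      then have "((\<lambda>x. ((deriv ^^ m) (f \<tau>) (w + x) - (deriv ^^ m) (f \<tau>) w) / x) \<longlongrightarrow> (deriv ^^ Suc m) (f \<tau>) w) (at 0)"
        by (simp only: DERIV_def)
      moreover have "filterlim h (at 0) sequentially"
        using h0 h(1) by (simp add: filterlim_at)
      ultimately show "(\<lambda>n. ((deriv ^^ m) (f \<tau>) (w + h n) - (deriv ^^ m) (f \<tau>) w) / h n) \<longlonglongrightarrow> (deriv ^^ Suc m) (f \<tau>) w"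
        by (rule filterlim_compose)
    qed
  qed
  from this[OF z] show ?thesis unfolding taylor_coeff_def by measurable
qed

lemma borel_measurable_vec_complex:
  fixes f :: "'a \<Rightarrow> complex ^ 'n::finite"
  assumes "\<And>i. (\<lambda>x. f x $ i) \<in> borel_measurable M"
  shows "f \<in> borel_measurable M"
proof -
  have "(\<lambda>x. f x \<bullet> axis i b) \<in> borel_measurable M" for i b
    unfolding inner_axis using assms by measurable
  then show ?thesis
    by (subst borel_measurable_euclidean_space) (auto simp: Basis_vec_def)
qed

lemma scaleR_matrix_vector_mult: "c *\<^sub>R (M *v x) = (c *\<^sub>R M) *v (x :: complex ^ 'n::finite)"
  by (simp add: matrix_vector_mult_def Finite_Cartesian_Product.vec_eq_iff scaleR_sum_right)

lemma matrix_diff_rdistrib: "(A - B) ** C = A ** C - B ** (C :: complex ^ 'n ^ 'n::finite)"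
  by (simp add: matrix_matrix_mult_def Finite_Cartesian_Product.vec_eq_iff sum_subtractf left_diff_distrib)

lemma norm_cvec: "norm (cvec v) = norm v"
  by (simp add: cvec_def norm_vec_def)

lemma norm_le_sup_norm:
  assumes "bounded (g ` {0..})" "\<tau> \<ge> 0"
  shows "norm (g \<tau>) \<le> sup_norm g"
proof -
  have "bdd_above ((\<lambda>t. norm (g t)) ` {0..})"
    using assms(1) by (auto simp: bounded_iff bdd_above_def)
  then show ?thesis unfolding sup_norm_def using assms(2) by (intro cSUP_upper) auto
qed

lemma norm_set_integral_le:
  fixes F :: "real \<Rightarrow> 'a::{banach, second_countable_topology}"
  assumes "set_integrable lborel A F" "integrable lborel \<phi>" "\<And>\<tau>. 0 \<le> \<phi> \<tau>" "\<And>\<tau>. \<tau> \<in> A \<Longrightarrow> norm (F \<tau>) \<le> C * \<phi> \<tau>" "C \<ge> 0"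
  shows "norm (LINT \<tau>:A|lborel. F \<tau>) \<le> C * (LINT \<tau>|lborel. \<phi> \<tau>)"
proof -
  have "norm (LINT \<tau>:A|lborel. F \<tau>) \<le> (LINT \<tau>|lborel. norm (indicator A \<tau> *\<^sub>R F \<tau>))"
    unfolding set_lebesgue_integral_def by (rule integral_norm_bound)
  also have "\<dots> \<le> (LINT \<tau>|lborel. C * \<phi> \<tau>)"
    using assms unfolding set_integrable_def
    by (intro integral_mono integrable_norm) (auto simp: indicator_def)
  finally show ?thesis by simp
qed

lemma compact_pos_lower_bound:
  fixes f :: "'a::topological_space \<Rightarrow> real"
  assumes "compact K" "continuous_on K f" "\<And>w. w \<in> K \<Longrightarrow> f w > 0"
  obtains e where "e > 0" "\<And>w. w \<in> K \<Longrightarrow> e \<le> f w"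
proof (cases "K = {}")
  case False
  then obtain w0 where "w0 \<in> K" "\<And>w. w \<in> K \<Longrightarrow> f w0 \<le> f w"
    using continuous_attains_inf[OF assms(1) False assms(2)] by blast
  then show ?thesis using assms(3) that by blast
qed (use that[of 1] in auto)

lemma compact_norm_upper_bound:
  fixes f :: "'a::topological_space \<Rightarrow> 'b::real_normed_vector"
  assumes "compact K" "continuous_on K f"
  obtains B where "B > 0" "\<And>w. w \<in> K \<Longrightarrow> norm (f w) \<le> B"
  using compact_imp_bounded[OF compact_continuous_image[OF assms(2,1)]]
  unfolding bounded_pos by auto

section \<open>Symbols of the matrix functions on the sector\<close>

locale unstable_spectrum = jordan_blocks ix ss us
  for ix :: "'n::finite \<Rightarrow> nat" and ss us +
  fixes p :: real
  assumes p: "0 < p" "p < 1"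
    and nonzero: "\<And>n z. (n, z) \<in> set us \<Longrightarrow> z \<noteq> 0"
    and unstable: "\<And>n z. (n, z) \<in> set us \<Longrightarrow> \<bar>Arg z\<bar> < p * pi / 2"
begin

definition sector :: "complex set" where
  "sector = {w. Re w > 0 \<and> \<bar>Arg w\<bar> < p * pi / 2}"

text \<open>
  The growth rate \<open>w\<^bsup>1/p\<^esup>\<close> of the exponential part \<open>exp (t w\<^bsup>1/p\<^esup>) / p\<close> of \<open>E\<^sub>p(t\<^bsup>p\<^esup> w)\<close>.
\<close>
definition rate :: "complex \<Rightarrow> complex" where
  "rate w = w powr of_real (1 / p)"

definition rate_deriv :: "complex \<Rightarrow> complex" where
  "rate_deriv w = of_real (1 / p) * w powr (of_real (1 / p) - 1)"

text \<open>
  The symbol of the matrix \<open>C\<close> on the unstable blocks.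
\<close>
definition defect :: "real \<Rightarrow> complex \<Rightarrow> complex" where
  "defect s w = mittag_leffler p 1 (of_real (s powr p) * w) - 1 / of_real p * exp (of_real s * rate w)"

lemma p_pi: "p * pi / 2 < pi / 2"
  using p mult_strict_right_mono[of p 1 pi] by simp

lemma sector_nonpos: "w \<in> sector \<Longrightarrow> w \<notin> \<real>\<^sub>\<le>\<^sub>0" "w \<in> sector \<Longrightarrow> w \<noteq> 0"
  by (auto simp: sector_def complex_nonpos_Reals_iff)

lemma open_sector: "open sector"
proof -
  have "continuous_on {w. Re w > 0} Arg"
    by (intro continuous_at_imp_continuous_on ballI continuous_at_Arg) (auto simp: complex_nonpos_Reals_iff)
  then have "open ({w. Re w > 0} \<inter> Arg -` {- (p * pi / 2)<..<p * pi / 2})"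
    by (rule continuous_open_preimage) (auto simp: open_halfspace_Re_gt)
  moreover have "{w. Re w > 0} \<inter> Arg -` {- (p * pi / 2)<..<p * pi / 2} = sector"
    by (auto simp: sector_def)
  ultimately show ?thesis by simp
qed

lemma us_in_sector: "(n, z) \<in> set us \<Longrightarrow> z \<in> sector"
proof -
  assume z: "(n, z) \<in> set us"
  have "Re z = norm z * cos (Arg z)"
    using arg_cong[OF rcis_cmod_Arg[of z], of Re] by (simp add: rcis_def)
  moreover have "cos (Arg z) > 0"
    using unstable[OF z] p_pi by (intro cos_gt_zero_pi) linarith+
  ultimately show "z \<in> sector" using unstable[OF z] nonzero[OF z] by (simp add: sector_def)
qed

lemma rate_has_deriv: "w \<in> sector \<Longrightarrow> (rate has_field_derivative rate_deriv w) (at w)"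
  unfolding rate_def rate_deriv_def using sector_nonpos by (intro has_field_derivative_powr) auto

lemma rate_holo [holomorphic_intros]: "rate holomorphic_on sector"
  using rate_has_deriv open_sector by (auto simp: holomorphic_on_open)

lemma rate_deriv_holo [holomorphic_intros]: "rate_deriv holomorphic_on sector"
  unfolding rate_deriv_def using sector_nonpos by (intro holomorphic_intros) auto

text \<open>
  This is where the opening angle of the sector matters: the argument of \<open>w\<^bsup>1/p\<^esup>\<close> is \<open>Arg w / p\<close>.
\<close>
lemma Re_rate_pos: "w \<in> sector \<Longrightarrow> Re (rate w) > 0"
proof -
  assume w: "w \<in> sector"
  then have "w \<noteq> 0" by (rule sector_nonpos)
  then have "rate w = exp (Ln w / of_real p)" by (simp add: rate_def powr_def)
  then have "Re (rate w) = exp (Re (Ln w) / p) * cos (Arg w / p)"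
    using \<open>w \<noteq> 0\<close> by (simp add: Re_exp Arg_eq_Im_Ln)
  moreover have "\<bar>Arg w / p\<bar> < pi / 2" using w p by (simp add: sector_def field_simps)
  then have "cos (Arg w / p) > 0" by (intro cos_gt_zero_pi) linarith+
  ultimately show ?thesis by simp
qed

lemma ml_holo: "mittag_leffler p 1 holomorphic_on A" "mittag_leffler p p holomorphic_on A"
  unfolding mittag_leffler_def using fps_conv_radius_ml_1 fps_conv_radius_ml_p p
  by (auto intro!: holomorphic_on_eval_fps)

lemma ml_has_deriv: "(mittag_leffler p 1 has_field_derivative mittag_leffler p p z / of_real p) (at z)"
proof -
  have "(mittag_leffler p 1 has_field_derivative eval_fps (fps_deriv (ml_fps p 1)) z) (at z)"
    unfolding mittag_leffler_def using fps_conv_radius_ml_1 p by (intro has_field_derivative_eval_fps) auto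
  also have "eval_fps (fps_deriv (ml_fps p 1)) z = mittag_leffler p p z / of_real p"
    unfolding fps_deriv_ml[OF p(1)] mittag_leffler_def using fps_conv_radius_ml_p[OF p(1)]
    by (subst eval_fps_mult) (auto simp: divide_inverse mult.commute)
  finally show ?thesis .
qed

lemma ml_scaled_holo: "(\<lambda>w. mittag_leffler p 1 (of_real a * w)) holomorphic_on A"
   "(\<lambda>w. mittag_leffler p p (of_real a * w)) holomorphic_on A"
  using holomorphic_on_compose[of "\<lambda>w. of_real a * w" A "mittag_leffler p 1"]
    holomorphic_on_compose[of "\<lambda>w. of_real a * w" A "mittag_leffler p p"] ml_holo
  by (auto simp: o_def intro!: holomorphic_intros)

lemma defect_holo: "defect s holomorphic_on sector"
  unfolding defect_def by (intro holomorphic_intros ml_scaled_holo)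

text \<open>
  Up to the factor \<open>s / p\<close>, the \<open>w\<close>-derivative of the defect is the difference between the
  fundamental solution \<open>s\<^bsup>p-1\<^esup> E\<^bsub>p,p\<^esub>(s\<^bsup>p\<^esup> w)\<close> and its exponential part. This turns the estimate for
  \<open>E\<^sub>p\<close> into one for \<open>E\<^bsub>p,p\<^esub>\<close>.
\<close>
lemma defect_has_deriv:
  assumes "w \<in> sector" "s > 0"
  shows "(defect s has_field_derivative of_real (s / p) *
     (of_real (s powr (p - 1)) * mittag_leffler p p (of_real (s powr p) * w) - rate_deriv w * exp (of_real s * rate w))) (at w)"
proof -
  have "s powr p = s * s powr (p - 1)" using assms by (simp add: powr_diff)
  then have e: "complex_of_real (s powr p) = of_real s * of_real (s powr (p - 1))" by simp
  have "((\<lambda>w. mittag_leffler p 1 (of_real (s powr p) * w)) has_field_derivative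
      mittag_leffler p p (of_real (s powr p) * w) / of_real p * of_real (s powr p)) (at w)"
    by (rule DERIV_chain2[OF ml_has_deriv]) (auto intro!: derivative_eq_intros)
  moreover have "((\<lambda>w. 1 / of_real p * exp (of_real s * rate w)) has_field_derivative
      1 / of_real p * (exp (of_real s * rate w) * (of_real s * rate_deriv w))) (at w)"
    using rate_has_deriv[OF assms(1)] p by (auto intro!: derivative_eq_intros)
  ultimately have "(defect s has_field_derivative
     mittag_leffler p p (of_real (s powr p) * w) / of_real p * of_real (s powr p) -
     1 / of_real p * (exp (of_real s * rate w) * (of_real s * rate_deriv w))) (at w)"
    unfolding defect_def by (rule DERIV_diff)
  then show ?thesis
    unfolding e by (simp add: algebra_simps)
qed

lemma B_mat_eq: "B_mat ix p ss us t = unstable_fun (\<lambda>w. 1 / of_real p * exp (of_real t * rate w))"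
proof -
  have "Psi p t z = taylor_coeff (\<lambda>w. 1 / of_real p * exp (of_real t * rate w)) z" for z
    by (rule ext) (simp add: Psi_def taylor_coeff_def rate_def)
  then show ?thesis by (simp add: B_mat_def unstable_fun_def)
qed

lemma B_tilde_eq: "B_tilde ix p ss us t = unstable_fun (\<lambda>w. of_real t * rate_deriv w * exp (of_real t * rate w))"
proof -
  have "Psi_tilde p t z = taylor_coeff (deriv (\<lambda>w. exp (of_real t * rate w))) z" for z
    unfolding rate_def by (rule ext) (simp add: Psi_tilde_def taylor_coeff_def funpow_Suc_right del: funpow.simps)
  then have "B_tilde ix p ss us t = unstable_fun (deriv (\<lambda>w. exp (of_real t * rate w)))"
    by (simp add: B_tilde_def unstable_fun_def)
  also have "\<dots> = unstable_fun (\<lambda>w. of_real t * rate_deriv w * exp (of_real t * rate w))"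
  proof (rule unstable_fun_cong[OF open_sector])
    show "deriv (\<lambda>w. exp (of_real t * rate w)) holomorphic_on sector"
      by (intro holomorphic_deriv holomorphic_intros open_sector)
    fix w assume "w \<in> sector"
    then show "deriv (\<lambda>w. exp (of_real t * rate w)) w = of_real t * rate_deriv w * exp (of_real t * rate w)"
      using rate_has_deriv by (intro DERIV_imp_deriv) (auto intro!: derivative_eq_intros)
  qed (rule us_in_sector)
  finally show ?thesis .
qed

lemma scaled_projected_apply:
  assumes "f holomorphic_on sector"
  shows "c *\<^sub>R (unstable_fun f *v pi_u ix ss us x) = unstable_fun (\<lambda>w. of_real c * f w) *v x"
proof -
  have "unstable_fun f ** unstable_fun (\<lambda>_. 1) = unstable_fun f"
    using unstable_fun_mult[OF open_sector assms, of "\<lambda>_. 1"] us_in_sector by simp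
  then show ?thesis
    unfolding pi_u_def unstable_fun_one matrix_vector_mul_assoc scaleR_matrix_vector_mult
    using unstable_fun_scaleR[OF open_sector assms us_in_sector] by simp
qed

lemma C_B_tilde_eq:
  "C_mat ix p ss us t ** B_tilde ix p ss us (- \<tau>) =
   unstable_fun (\<lambda>w. defect t w * (of_real (- \<tau>) * rate_deriv w * exp (of_real (- \<tau>) * rate w)))"
proof -
  let ?E = "unstable_fun (\<lambda>w. mittag_leffler p 1 (of_real (t powr p) * w))"
  let ?b = "\<lambda>w. 1 / of_real p * exp (of_real t * rate w)"
  let ?h = "\<lambda>w. of_real (- \<tau>) * rate_deriv w * exp (of_real (- \<tau>) * rate w)"
  have holo: "?b holomorphic_on sector" "?h holomorphic_on sector" by (intro holomorphic_intros)+
  have one: "unstable_fun (\<lambda>_. 1) ** unstable_fun f = unstable_fun f" "unstable_fun f ** unstable_fun (\<lambda>_. 1) = unstable_fun f"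
    if "f holomorphic_on sector" for f
    using unstable_fun_mult[OF open_sector _ that, of "\<lambda>_. 1"] unstable_fun_mult[OF open_sector that, of "\<lambda>_. 1"]
      us_in_sector by simp_all
  have "C_mat ix p ss us t ** unstable_fun (\<lambda>_. 1) =
      mittag_leffler_mat p 1 (t powr p *\<^sub>R A_mat ix ss us) ** unstable_fun (\<lambda>_. 1) - unstable_fun ?b ** unstable_fun (\<lambda>_. 1)"
    unfolding C_mat_def B_mat_eq by (rule matrix_diff_rdistrib)
  also have "\<dots> = ?E - unstable_fun ?b"
    using mittag_leffler_mat_unstable[OF fps_conv_radius_ml_1[OF p(1)]] one(2)[OF holo(1)] by simp
  also have "\<dots> = unstable_fun (defect t)"
    unfolding defect_def by (rule unstable_fun_diff[OF open_sector ml_scaled_holo(1) holo(1) us_in_sector])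
  finally have C: "C_mat ix p ss us t ** unstable_fun (\<lambda>_. 1) = unstable_fun (defect t)" .
  have "C_mat ix p ss us t ** B_tilde ix p ss us (- \<tau>) = (C_mat ix p ss us t ** unstable_fun (\<lambda>_. 1)) ** unstable_fun ?h"
    unfolding B_tilde_eq matrix_mul_assoc[symmetric] one(1)[OF holo(2)] ..
  also have "\<dots> = unstable_fun (\<lambda>w. defect t w * ?h w)"
    unfolding C by (rule unstable_fun_mult[OF open_sector defect_holo holo(2) us_in_sector])
  finally show ?thesis .
qed

lemma B_B_tilde_eq:
  "B_mat ix p ss us t ** B_tilde ix p ss us (- \<tau>) =
   unstable_fun (\<lambda>w. 1 / of_real p * exp (of_real t * rate w) * (of_real (- \<tau>) * rate_deriv w * exp (of_real (- \<tau>) * rate w)))"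
  unfolding B_mat_eq B_tilde_eq
  by (intro unstable_fun_mult[OF open_sector _ _ us_in_sector] holomorphic_intros)

lemma ml_projected_apply:
  "c *\<^sub>R (mittag_leffler_mat p p (a *\<^sub>R A_mat ix ss us) *v pi_u ix ss us x) =
   unstable_fun (\<lambda>w. of_real c * mittag_leffler p p (of_real a * w)) *v x"
  unfolding pi_u_def unstable_fun_one matrix_vector_mul_assoc
    mittag_leffler_mat_unstable[OF fps_conv_radius_ml_p[OF p(1)]] scaleR_matrix_vector_mult
  using unstable_fun_scaleR[OF open_sector ml_scaled_holo(2) us_in_sector] by simp

section \<open>Uniform bounds for the symbols\<close>

text \<open>
  The compact set on which symbols have to be bounded.
\<close>
definition disks :: "real \<Rightarrow> complex set" where
  "disks r = (\<Union>(n, z)\<in>set us. cball z r)"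

lemma compact_disks: "compact (disks r)"
  unfolding disks_def by (intro compact_UN) auto

text \<open>
  The doubled radius leaves room for one Cauchy estimate around every point of \<open>disks r\<close>.
\<close>
lemma disks_in_sector: obtains r where "0 < r" "r \<le> 1" "disks (2 * r) \<subseteq> sector"
proof -
  have "\<exists>r. 0 < r \<and> r \<le> 1 \<and> (\<forall>x\<in>F. cball (snd x) (2 * r) \<subseteq> sector)"
    if "finite F" "F \<subseteq> set us" for F
    using that
  proof induction
    case empty
    then show ?case by (intro exI[of _ 1]) auto
  next
    case (insert x F)
    then obtain r where r: "0 < r" "r \<le> 1" "\<forall>x\<in>F. cball (snd x) (2 * r) \<subseteq> sector" by auto
    have "snd x \<in> sector" using insert us_in_sector[of "fst x" "snd x"] by auto
    then obtain e where e: "e > 0" "cball (snd x) e \<subseteq> sector"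
      using open_sector open_contains_cball by blast
    have "cball y (2 * min r (e / 2)) \<subseteq> cball y (2 * r)" "cball y (2 * min r (e / 2)) \<subseteq> cball y e" for y :: complex
      by (auto simp: subset_cball)
    then have "\<forall>y\<in>insert x F. cball (snd y) (2 * min r (e / 2)) \<subseteq> sector"
      using r(3) e(2) by blast
    then show ?case using r e by (intro exI[of _ "min r (e / 2)"]) auto
  qed
  from this[of "set us"] obtain r where "0 < r" "r \<le> 1" "\<forall>x\<in>set us. cball (snd x) (2 * r) \<subseteq> sector" by auto
  then have "disks (2 * r) \<subseteq> sector" unfolding disks_def by (auto simp: case_prod_unfold)
  with \<open>0 < r\<close> \<open>r \<le> 1\<close> show ?thesis by (rule that)
qed

text \<open>
  For \<open>w\<close> in a compact part of the sector, \<open>s\<^bsup>p\<^esup> w\<close> has the argument of \<open>w\<close> and modulus at least 2 as soon as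
  \<open>s\<close> is large, so the asymptotics apply at \<open>z = s\<^bsup>p\<^esup> w\<close>.
\<close>
lemma defect_decay:
  assumes K: "compact K" "K \<subseteq> sector"
  obtains s0 M where "s0 > 0" "M > 0" "\<And>s w. s \<ge> s0 \<Longrightarrow> w \<in> K \<Longrightarrow> norm (defect s w) \<le> M * s powr (- p)"
proof -
  obtain C where C: "C \<ge> 0" "\<And>z. norm z \<ge> 2 \<Longrightarrow> \<bar>Arg z\<bar> \<le> p * pi / 2 \<Longrightarrow>
      norm (mittag_leffler p 1 z - 1 / of_real p * exp (z powr of_real (1 / p))) \<le> C / norm z"
    by (rule ml_asymptotics[OF p], rule that)
  obtain \<rho> where \<rho>: "\<rho> > 0" "\<And>w. w \<in> K \<Longrightarrow> \<rho> \<le> norm w"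
  proof (rule compact_pos_lower_bound[OF K(1), of norm])
    show "continuous_on K norm" by (intro continuous_intros)
    show "norm w > 0" if "w \<in> K" for w using that K(2) sector_nonpos(2) by auto
  qed (rule that)
  \<comment> \<open>this makes \<open>s\<^bsup>p\<^esup> \<bar>w\<bar> \<ge> 2\<close> for \<open>s \<ge> s0\<close>\<close>
  define s0 where "s0 = (2 / \<rho>) powr (1 / p)"
  have s0: "s0 > 0" "s0 powr p = 2 / \<rho>" using \<rho> p by (auto simp: s0_def powr_powr)
  have "norm (defect s w) \<le> (C / \<rho> + 1) * s powr (- p)" if s: "s \<ge> s0" and w: "w \<in> K" for s w
  proof -
    have spos: "s > 0" using s s0 by linarith
    have w0: "w \<noteq> 0" and wS: "w \<in> sector" using w K(2) sector_nonpos(2) by auto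
    define z where "z = of_real (s powr p) * w"
    have "s0 powr p \<le> s powr p" using s s0 p by (intro powr_mono2) auto
    then have "(2 / \<rho>) * \<rho> \<le> s powr p * norm w"
      using \<rho> w s0 by (intro mult_mono) auto
    then have z2: "norm z \<ge> 2" using \<rho> by (simp add: z_def norm_mult)
    have Arg: "Arg z = Arg w" using spos unfolding z_def by (intro Arg_times_of_real) auto
    have "z powr of_real (1 / p) = of_real s * rate w"
    proof -
      have "Ln z = of_real (p * ln s) + Ln w"
        unfolding z_def using spos w0 by (subst Ln_times_of_real) (auto simp: ln_powr Ln_of_real)
      then have "z powr of_real (1 / p) = exp (of_real (ln s) + of_real (1 / p) * Ln w)"
        using z2 p by (auto simp: powr_def field_simps)
      also have "\<dots> = of_real s * rate w"
        using spos w0 unfolding exp_add exp_of_real by (simp add: rate_def powr_def)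
      finally show ?thesis .
    qed
    then have "norm (defect s w) \<le> C / norm z"
      using C(2)[OF z2] Arg wS unfolding defect_def z_def sector_def by simp
    also have "norm z = s powr p * norm w" by (simp add: z_def norm_mult)
    also have "C / (s powr p * norm w) \<le> C / (s powr p * \<rho>)"
      using C(1) spos \<rho> w w0 by (intro divide_left_mono mult_left_mono mult_pos_pos) auto
    also have "\<dots> = C / \<rho> * s powr (- p)" using spos by (simp add: powr_minus divide_inverse)
    also have "\<dots> \<le> (C / \<rho> + 1) * s powr (- p)" by (intro mult_right_mono) auto
    finally show ?thesis .
  qed
  then show ?thesis using s0(1) C \<rho> by (intro that[of s0 "C / \<rho> + 1"]) (auto intro: add_nonneg_pos)
qed

lemma ml_bounded:
  assumes K: "compact K"
  obtains M where "M > 0"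
    "\<And>s w. 0 \<le> s \<Longrightarrow> s \<le> s0 \<Longrightarrow> w \<in> K \<Longrightarrow> norm (mittag_leffler p 1 (of_real (s powr p) * w)) \<le> M"
    "\<And>s w. 0 \<le> s \<Longrightarrow> s \<le> s0 \<Longrightarrow> w \<in> K \<Longrightarrow> norm (mittag_leffler p p (of_real (s powr p) * w)) \<le> M"
proof -
  obtain R where R: "R > 0" "\<And>w. w \<in> K \<Longrightarrow> norm w \<le> R"
    using compact_norm_upper_bound[OF K continuous_on_id] by auto
  obtain M1 where M1: "M1 > 0" "\<And>z. z \<in> cball 0 (s0 powr p * R) \<Longrightarrow> norm (mittag_leffler p 1 z) \<le> M1"
    by (rule compact_norm_upper_bound[OF compact_cball holomorphic_on_imp_continuous_on[OF ml_holo(1)]], rule that)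
  obtain M2 where M2: "M2 > 0" "\<And>z. z \<in> cball 0 (s0 powr p * R) \<Longrightarrow> norm (mittag_leffler p p z) \<le> M2"
    by (rule compact_norm_upper_bound[OF compact_cball holomorphic_on_imp_continuous_on[OF ml_holo(2)]], rule that)
  have "of_real (s powr p) * w \<in> cball 0 (s0 powr p * R)" if "0 \<le> s" "s \<le> s0" "w \<in> K" for s w
    using that R p by (auto simp: norm_mult intro!: mult_mono powr_mono2)
  then show ?thesis using M1 M2 by (intro that[of "max M1 M2"]) (auto simp: le_max_iff_disj)
qed

lemma rate_bounds:
  assumes K: "compact K" "K \<subseteq> sector"
  obtains c V where "c > 0" "V > 0"
    "\<And>w. w \<in> K \<Longrightarrow> c \<le> Re (rate w)" "\<And>w. w \<in> K \<Longrightarrow> norm (rate w) \<le> V" "\<And>w. w \<in> K \<Longrightarrow> norm (rate_deriv w) \<le> V"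
proof -
  have cont: "continuous_on K rate" "continuous_on K rate_deriv"
    by (intro continuous_on_subset[OF holomorphic_on_imp_continuous_on K(2)] rate_holo rate_deriv_holo)+
  obtain c where c: "c > 0" "\<And>w. w \<in> K \<Longrightarrow> c \<le> Re (rate w)"
  proof (rule compact_pos_lower_bound[OF K(1), of "\<lambda>w. Re (rate w)"])
    show "continuous_on K (\<lambda>w. Re (rate w))" using cont(1) by (rule continuous_on_Re)
    show "Re (rate w) > 0" if "w \<in> K" for w using Re_rate_pos[OF subsetD[OF K(2) that]] .
  qed (rule that)
  obtain V1 where V1: "V1 > 0" "\<And>w. w \<in> K \<Longrightarrow> norm (rate w) \<le> V1"
    by (rule compact_norm_upper_bound[OF K(1) cont(1)], rule that)
  obtain V2 where V2: "V2 > 0" "\<And>w. w \<in> K \<Longrightarrow> norm (rate_deriv w) \<le> V2"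
    by (rule compact_norm_upper_bound[OF K(1) cont(2)], rule that)
  show ?thesis using c V1 V2 by (intro that[of c "max V1 V2"]) (auto simp: le_max_iff_disj)
qed

text \<open>
  The symbol of the convolution kernel of the variation of constants formula; by the value \<open>0\<close> of \<open>powr\<close>
  at zero it vanishes for \<open>s = 0\<close>.
\<close>
definition ml_kernel :: "real \<Rightarrow> complex \<Rightarrow> complex" where
  "ml_kernel s w = of_real (s powr (p - 1)) * mittag_leffler p p (of_real (s powr p) * w)"

definition exp_kernel :: "real \<Rightarrow> complex \<Rightarrow> complex" where
  "exp_kernel s w = rate_deriv w * exp (of_real s * rate w)"

lemma norm_exp_kernel_le:
  assumes "norm (rate_deriv w) \<le> V" "norm (rate w) \<le> V" "c \<le> Re (rate w)"
  shows "s \<le> 0 \<Longrightarrow> norm (exp_kernel s w) \<le> V * exp (c * s)"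
    "0 \<le> t \<Longrightarrow> norm (exp_kernel (t - \<tau>) w) \<le> V * exp (t * V) * norm (exp (of_real (- \<tau>) * rate w))"
proof -
  have V: "V \<ge> 0" using assms(1) norm_ge_zero order_trans by blast
  show "norm (exp_kernel s w) \<le> V * exp (c * s)" if "s \<le> 0"
    unfolding exp_kernel_def norm_mult using assms V that
    by (intro mult_mono) (auto simp: norm_exp_eq_Re mult.commute[of c] intro: mult_left_mono_neg)
  show "norm (exp_kernel (t - \<tau>) w) \<le> V * exp (t * V) * norm (exp (of_real (- \<tau>) * rate w))" if "0 \<le> t"
  proof -
    have "exp (of_real (t - \<tau>) * rate w) = exp (of_real t * rate w) * exp (of_real (- \<tau>) * rate w)"
      by (simp add: algebra_simps flip: exp_add)
    moreover have "Re (rate w) \<le> V" using assms(2) complex_Re_le_cmod order_trans by blast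
    then have "norm (exp (of_real t * rate w)) \<le> exp (t * V)"
      using that by (simp add: norm_exp_eq_Re mult_left_mono)
    ultimately show ?thesis unfolding exp_kernel_def using assms(1) V
      by (simp add: norm_mult mult.assoc[symmetric] mult_mono mult_right_mono)
  qed
qed

text \<open>
  The cancellation that the second estimate rests on. For large \<open>s\<close> the difference is \<open>p / s\<close> times the
  derivative of the defect, so Cauchy's estimate on disks of radius \<open>r\<close> turns the decay \<open>s\<^bsup>-p\<^esup>\<close> of
  the defect into the integrable \<open>s\<^bsup>-1-p\<^esup>\<close>. For small \<open>s\<close> both terms are \<open>O(s\<^bsup>p-1\<^esup>)\<close>, and for \<open>s \<le> 0\<close>
  only a decaying exponential is left.
\<close>
lemma ml_kernel_minus_exp_kernel_bound:
  assumes r: "0 < r" "disks (2 * r) \<subseteq> sector"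
  obtains c s0 M where "c > 0" "s0 > 0" "M > 0"
    "\<And>s w. w \<in> disks r \<Longrightarrow> norm ((if s > 0 then ml_kernel s w else 0) - exp_kernel s w) \<le> M * envelope p c s0 s"
proof -
  have sub: "disks r \<subseteq> sector"
    using r unfolding disks_def by (force simp: subset_iff)
  obtain s0 M1 where M1: "s0 > 0" "M1 > 0" "\<And>s w. s \<ge> s0 \<Longrightarrow> w \<in> disks (2 * r) \<Longrightarrow> norm (defect s w) \<le> M1 * s powr (- p)"
    by (rule defect_decay[OF compact_disks r(2)], rule that)
  obtain c V where V: "c > 0" "V > 0"
    "\<And>w. w \<in> disks r \<Longrightarrow> c \<le> Re (rate w)" "\<And>w. w \<in> disks r \<Longrightarrow> norm (rate w) \<le> V" "\<And>w. w \<in> disks r \<Longrightarrow> norm (rate_deriv w) \<le> V"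
    by (rule rate_bounds[OF compact_disks sub], rule that)
  obtain M2 where M2: "M2 > 0"
    "\<And>s w. 0 \<le> s \<Longrightarrow> s \<le> s0 \<Longrightarrow> w \<in> disks r \<Longrightarrow> norm (mittag_leffler p 1 (of_real (s powr p) * w)) \<le> M2"
    "\<And>s w. 0 \<le> s \<Longrightarrow> s \<le> s0 \<Longrightarrow> w \<in> disks r \<Longrightarrow> norm (mittag_leffler p p (of_real (s powr p) * w)) \<le> M2"
    by (rule ml_bounded[OF compact_disks], rule that)
  define M where "M = V + (M2 + V * exp (s0 * V) * s0 powr (1 - p)) + p * M1 / r"
  have parts: "0 \<le> V" "0 \<le> M2 + V * exp (s0 * V) * s0 powr (1 - p)" "0 \<le> p * M1 / r"
    using V M1 M2 p r by auto
  then have M: "V \<le> M" "M2 + V * exp (s0 * V) * s0 powr (1 - p) \<le> M" "p * M1 / r \<le> M" "M > 0"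
    using V(2) unfolding M_def by linarith+
  have "norm ((if s > 0 then ml_kernel s w else 0) - exp_kernel s w) \<le> M * envelope p c s0 s" if w: "w \<in> disks r" for s w
  proof -
    consider "s \<le> 0" | "0 < s" "s \<le> s0" | "0 < s" "s0 < s" by linarith
    then show ?thesis
    proof cases
      case 1
      have "norm (exp_kernel s w) \<le> V * exp (c * s)"
        using V w 1 by (intro norm_exp_kernel_le) auto
      also have "\<dots> \<le> M * exp (c * s)" using M by (intro mult_right_mono) auto
      finally show ?thesis using 1 by (simp add: envelope_def)
    next
      case 2
      have "norm (ml_kernel s w) \<le> s powr (p - 1) * M2"
        unfolding ml_kernel_def norm_mult using M2 w 2 by (intro mult_mono) auto
      moreover have "norm (exp_kernel s w) \<le> V * exp (s0 * V) * s0 powr (1 - p) * s powr (p - 1)"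
      proof -
        have "norm (exp_kernel s w) \<le> V * exp (s * V)"
          using norm_exp_kernel_le(2)[OF V(5)[OF w] V(4)[OF w] V(3)[OF w], of s 0] 2 by simp
        also have "\<dots> \<le> V * exp (s0 * V)" using V 2 by (intro mult_left_mono) auto
        also have "\<dots> \<le> V * exp (s0 * V) * (s0 powr (1 - p) * s powr (p - 1))"
        proof -
          have "s powr (1 - p) \<le> s0 powr (1 - p)" using 2 p by (intro powr_mono2) auto
          then have "s powr (1 - p) * s powr (p - 1) \<le> s0 powr (1 - p) * s powr (p - 1)"
            by (intro mult_right_mono) auto
          then have "1 \<le> s0 powr (1 - p) * s powr (p - 1)"
            using 2 by (simp flip: powr_add)
          then show ?thesis using V mult_left_mono[of 1 _ "V * exp (s0 * V)"] by simp
        qed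
        finally show ?thesis by (simp add: mult.assoc)
      qed
      ultimately have "norm (ml_kernel s w - exp_kernel s w) \<le>
          (M2 + V * exp (s0 * V) * s0 powr (1 - p)) * s powr (p - 1)"
        using norm_triangle_ineq4[of "ml_kernel s w" "exp_kernel s w"] by (simp add: algebra_simps)
      also have "\<dots> \<le> M * s powr (p - 1)" using M by (intro mult_right_mono) auto
      finally show ?thesis using 2 by (simp add: envelope_def)
    next
      case 3
      have cb: "cball w r \<subseteq> disks (2 * r)"
      proof -
        obtain n z where "(n, z) \<in> set us" "w \<in> cball z r" using w unfolding disks_def by auto
        have "cball w r \<subseteq> cball z (2 * r)"
        proof
          fix x assume "x \<in> cball w r"
          then show "x \<in> cball z (2 * r)" using \<open>w \<in> cball z r\<close> dist_triangle[of z x w] by simp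
        qed
        then show ?thesis using \<open>(n, z) \<in> set us\<close> unfolding disks_def by blast
      qed
      have ws: "w \<in> sector" using w sub by blast
      have "norm ((deriv ^^ 1) (defect s) w) \<le> fact 1 * (M1 * s powr (- p)) / r ^ 1"
      proof (rule Cauchy_inequality)
        show "defect s holomorphic_on ball w r"
          using cb r(2) ball_subset_cball[of w r] by (intro holomorphic_on_subset[OF defect_holo]) blast
        show "continuous_on (cball w r) (defect s)"
          using cb r(2) by (intro continuous_on_subset[OF holomorphic_on_imp_continuous_on[OF defect_holo]]) blast
        show "norm (defect s x) \<le> M1 * s powr (- p)" if "norm (w - x) = r" for x
          using that cb 3 by (intro M1(3)) (auto simp: dist_norm subset_iff)
      qed (rule r(1))
      moreover have "deriv (defect s) w = of_real (s / p) * (ml_kernel s w - exp_kernel s w)"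
        using defect_has_deriv[OF ws 3(1)] unfolding ml_kernel_def exp_kernel_def by (rule DERIV_imp_deriv)
      ultimately have "s / p * norm (ml_kernel s w - exp_kernel s w) \<le> M1 * s powr (- p) / r"
        using 3 p by (simp add: norm_mult norm_divide)
      then have "norm (ml_kernel s w - exp_kernel s w) \<le> p * M1 / r * (s powr (- p) / s)"
        using 3 p r by (simp add: field_simps)
      also have "s powr (- p) / s = s powr (- 1 - p)"
        using 3 by (simp add: powr_diff powr_minus field_simps)
      also have "p * M1 / r * s powr (- 1 - p) \<le> M * s powr (- 1 - p)"
        using M by (intro mult_right_mono) auto
      finally show ?thesis using 3 by (simp add: envelope_def)
    qed
  qed
  then show ?thesis by (rule that[OF V(1) M1(1) M(4)])
qed


text \<open>
  The bridge from scalars to vectors: a measurable family of symbols that is dominated by an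
  integrable function on the disks gives an integrable vector function with the same bound up to
  a constant.
\<close>
lemma unstable_fun_apply_integrable:
  fixes g :: "real \<Rightarrow> real ^ 'n"
  assumes r: "0 < r" "r \<le> 1" "disks r \<subseteq> sector"
    and holo: "\<And>\<tau>. f \<tau> holomorphic_on sector"
    and meas: "\<And>w. w \<in> sector \<Longrightarrow> (\<lambda>\<tau>. f \<tau> w) \<in> borel_measurable borel"
    and \<phi>: "integrable lborel \<phi>"
    and le: "\<And>\<tau> w. \<tau> \<in> A \<Longrightarrow> w \<in> disks r \<Longrightarrow> norm (f \<tau> w) \<le> \<phi> \<tau>"
    and \<phi>0: "\<And>\<tau>. \<tau> \<in> A \<Longrightarrow> 0 \<le> \<phi> \<tau>"
    and A: "A \<in> sets borel" "A \<subseteq> {0..}"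
    and g: "continuous_on {0..} g" "bounded (g ` {0..})"
  shows "set_integrable lborel A (\<lambda>\<tau>. unstable_fun (f \<tau>) *v cvec (g \<tau>))"
    "\<And>\<tau>. \<tau> \<in> A \<Longrightarrow> norm (unstable_fun (f \<tau>) *v cvec (g \<tau>)) \<le> real CARD('n) ^ 2 / r ^ CARD('n) * sup_norm g * \<phi> \<tau>"
proof -
  show le': "norm (unstable_fun (f \<tau>) *v cvec (g \<tau>)) \<le> real CARD('n) ^ 2 / r ^ CARD('n) * sup_norm g * \<phi> \<tau>"
    if \<tau>: "\<tau> \<in> A" for \<tau>
  proof -
    have "norm (unstable_fun (f \<tau>) *v cvec (g \<tau>)) \<le> real CARD('n) ^ 2 / r ^ CARD('n) * \<phi> \<tau> * norm (cvec (g \<tau>))"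
    proof (rule norm_unstable_fun_le[OF open_sector holo r(1,2) _ \<phi>0[OF \<tau>]])
      show "cball z r \<subseteq> sector" if "(n, z) \<in> set us" for n z
        using that r(3) unfolding disks_def by blast
      show "norm (f \<tau> w) \<le> \<phi> \<tau>" if "(n, z) \<in> set us" "w \<in> cball z r" for n z w
        using that by (intro le[OF \<tau>]) (force simp: disks_def)
    qed
    also have "\<dots> \<le> real CARD('n) ^ 2 / r ^ CARD('n) * \<phi> \<tau> * sup_norm g"
      unfolding norm_cvec using r \<phi>0[OF \<tau>] A(2) \<tau> by (intro mult_left_mono norm_le_sup_norm g) auto
    finally show ?thesis by (simp add: mult_ac)
  qed
  have entry: "(\<lambda>\<tau>. (unstable_fun (f \<tau>) $ i) $ j) \<in> borel_measurable borel" for i j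
  proof (rule disjE[OF unstable_fun_entry[of i j]])
    assume "\<exists>n z m. (n, z) \<in> set us \<and> m < n \<and> (\<forall>f. (unstable_fun f $ i) $ j = taylor_coeff f z m)"
    then obtain n z m where nz: "(n, z) \<in> set us" and eq: "\<forall>f. (unstable_fun f $ i) $ j = taylor_coeff f z m"
      by (elim exE conjE) (rule that)
    show ?thesis unfolding eq[rule_format]
      by (rule borel_measurable_taylor_coeff[OF open_sector holo meas us_in_sector[OF nz]])
  qed auto
  have gi: "(\<lambda>\<tau>. indicator {0..} \<tau> *\<^sub>R g \<tau>) \<in> borel_measurable borel"
    using g(1) by (intro borel_measurable_continuous_on_indicator) auto
  have gj: "(\<lambda>\<tau>. indicator {0..} \<tau> *\<^sub>R g \<tau> $ j) \<in> borel_measurable borel" for j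
  proof -
    have "(\<lambda>\<tau>. (indicator {0..} \<tau> *\<^sub>R g \<tau>) \<bullet> axis j 1) \<in> borel_measurable borel"
      using gi by measurable
    then show ?thesis by (simp add: inner_axis)
  qed
  have gjc: "(\<lambda>\<tau>. complex_of_real (indicator {0..} \<tau> *\<^sub>R g \<tau> $ j)) \<in> borel_measurable borel" for j
    by (rule measurable_compose[OF gj borel_measurable_of_real])
  have "(\<lambda>\<tau>. indicator A \<tau> *\<^sub>R (unstable_fun (f \<tau>) *v cvec (g \<tau>))) \<in> borel_measurable borel"
  proof (rule borel_measurable_vec_complex)
    fix i
    have "(\<lambda>\<tau>. \<Sum>j\<in>UNIV. indicator A \<tau> *\<^sub>R ((unstable_fun (f \<tau>) $ i) $ j * of_real (indicator {0..} \<tau> *\<^sub>R g \<tau> $ j))) \<in> borel_measurable borel"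
      by (intro borel_measurable_sum borel_measurable_scaleR borel_measurable_times
          borel_measurable_indicator A(1) gjc entry)
    moreover have "(\<Sum>j\<in>UNIV. indicator A \<tau> *\<^sub>R ((unstable_fun (f \<tau>) $ i) $ j * of_real (indicator {0..} \<tau> *\<^sub>R g \<tau> $ j)))
       = (indicator A \<tau> *\<^sub>R (unstable_fun (f \<tau>) *v cvec (g \<tau>))) $ i" for \<tau>
    proof (cases "\<tau> \<in> A")
      case True
      then have "\<tau> \<ge> 0" using A(2) by auto
      then show ?thesis using True by (simp add: matrix_vector_mult_def cvec_def)
    qed simp
    ultimately show "(\<lambda>\<tau>. (indicator A \<tau> *\<^sub>R (unstable_fun (f \<tau>) *v cvec (g \<tau>))) $ i) \<in> borel_measurable borel"
      by simp
  qed
  then have F: "(\<lambda>\<tau>. indicator A \<tau> *\<^sub>R (unstable_fun (f \<tau>) *v cvec (g \<tau>))) \<in> borel_measurable lborel"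
    by simp
  have bound: "integrable lborel (\<lambda>\<tau>. real CARD('n) ^ 2 / r ^ CARD('n) * sup_norm g * \<phi> \<tau>)"
    using \<phi> by simp
  have dom: "norm (indicator A \<tau> *\<^sub>R (unstable_fun (f \<tau>) *v cvec (g \<tau>))) \<le>
      norm (real CARD('n) ^ 2 / r ^ CARD('n) * sup_norm g * \<phi> \<tau>)" for \<tau>
  proof (cases "\<tau> \<in> A")
    case True
    then show ?thesis using order_trans[OF le'[OF True] abs_ge_self] by simp
  qed simp
  show "set_integrable lborel A (\<lambda>\<tau>. unstable_fun (f \<tau>) *v cvec (g \<tau>))"
    unfolding set_integrable_def by (rule Bochner_Integration.integrable_bound[OF bound F AE_I2[OF dom]])
qed

section \<open>The two integral estimates\<close>

lemma defect_bounded: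
  assumes K: "compact K" "K \<subseteq> sector"
  obtains M where "M > 0" "\<And>s w. s \<ge> 0 \<Longrightarrow> w \<in> K \<Longrightarrow> norm (defect s w) \<le> M"
proof -
  obtain s0 M1 where M1: "s0 > 0" "M1 > 0" "\<And>s w. s \<ge> s0 \<Longrightarrow> w \<in> K \<Longrightarrow> norm (defect s w) \<le> M1 * s powr (- p)"
    by (rule defect_decay[OF K], rule that)
  obtain c V where V: "c > 0" "V > 0" "\<And>w. w \<in> K \<Longrightarrow> c \<le> Re (rate w)"
    "\<And>w. w \<in> K \<Longrightarrow> norm (rate w) \<le> V" "\<And>w. w \<in> K \<Longrightarrow> norm (rate_deriv w) \<le> V"
    by (rule rate_bounds[OF K], rule that)
  obtain M2 where M2: "M2 > 0"
    "\<And>s w. 0 \<le> s \<Longrightarrow> s \<le> s0 \<Longrightarrow> w \<in> K \<Longrightarrow> norm (mittag_leffler p 1 (of_real (s powr p) * w)) \<le> M2"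
    "\<And>s w. 0 \<le> s \<Longrightarrow> s \<le> s0 \<Longrightarrow> w \<in> K \<Longrightarrow> norm (mittag_leffler p p (of_real (s powr p) * w)) \<le> M2"
    by (rule ml_bounded[OF K(1)], rule that)
  define M where "M = M1 * s0 powr (- p) + (M2 + 1 / p * exp (s0 * V))"
  have parts: "0 < M1 * s0 powr (- p)" "0 < M2 + 1 / p * exp (s0 * V)"
    using M1 M2 p by (auto intro!: add_pos_pos)
  have "norm (defect s w) \<le> M" if s: "s \<ge> 0" and w: "w \<in> K" for s w
  proof (cases "s \<ge> s0")
    case True
    have "norm (defect s w) \<le> M1 * s powr (- p)" using M1 True w by auto
    also have "\<dots> \<le> M1 * s0 powr (- p)"
      using M1 True p by (intro mult_left_mono powr_mono2') auto
    finally show ?thesis using parts unfolding M_def by linarith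
  next
    case False
    have "Re (rate w) \<le> V" using V(4)[OF w] complex_Re_le_cmod order_trans by blast
    then have "s * Re (rate w) \<le> s0 * V"
      using False s V(2) by (meson less_eq_real_def linorder_not_le mult_left_mono mult_right_mono order_trans)
    then have "norm (1 / of_real p * exp (of_real s * rate w)) \<le> 1 / p * exp (s0 * V)"
      using p by (simp add: norm_mult norm_divide norm_exp_eq_Re divide_right_mono)
    moreover have "norm (mittag_leffler p 1 (of_real (s powr p) * w)) \<le> M2" using M2(2)[OF s _ w] False by simp
    ultimately have "norm (defect s w) \<le> M2 + 1 / p * exp (s0 * V)"
      unfolding defect_def by (intro order_trans[OF norm_triangle_ineq4] add_mono)
    then show ?thesis using parts unfolding M_def by linarith
  qed
  moreover have "M > 0" using parts unfolding M_def by linarith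
  ultimately show ?thesis by (intro that[of M])
qed

lemma ml_kernel_holo: "ml_kernel s holomorphic_on sector"
  unfolding ml_kernel_def by (intro holomorphic_intros ml_scaled_holo)

lemma exp_kernel_holo: "exp_kernel s holomorphic_on sector"
  unfolding exp_kernel_def by (intro holomorphic_intros)

lemma ml_kernel_measurable: "(\<lambda>\<tau>. ml_kernel (t - \<tau>) w) \<in> borel_measurable borel"
proof -
  have "mittag_leffler p p \<in> borel_measurable borel"
    by (intro borel_measurable_continuous_onI holomorphic_on_imp_continuous_on ml_holo)
  then show ?thesis unfolding ml_kernel_def by measurable
qed

lemma exp_kernel_measurable: "(\<lambda>\<tau>. exp_kernel (t - \<tau>) w) \<in> borel_measurable borel"
  unfolding exp_kernel_def by measurable

lemma ml_kernel_0 [simp]: "ml_kernel 0 w = 0"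
  by (simp add: ml_kernel_def)

text \<open>
  The factors \<open>\<tau>\<close> are not cancelled, so that this is the symbol of \<open>(p / \<tau>) B(t) Bt(-\<tau>)\<close> also at
  \<open>\<tau> = 0\<close>, where \<open>p / \<tau>\<close> is \<open>0\<close>.
\<close>
definition BB_symbol :: "real \<Rightarrow> real \<Rightarrow> complex \<Rightarrow> complex" where
  "BB_symbol t \<tau> w = of_real (p / \<tau>) * (1 / of_real p * exp (of_real t * rate w) *
     (of_real (- \<tau>) * rate_deriv w * exp (of_real (- \<tau>) * rate w)))"

lemma BB_symbol_eq: "\<tau> \<noteq> 0 \<Longrightarrow> BB_symbol t \<tau> w = - exp_kernel (t - \<tau>) w"
proof -
  assume "\<tau> \<noteq> 0"
  have "exp (of_real (t - \<tau>) * rate w) = exp (of_real t * rate w) * exp (of_real (- \<tau>) * rate w)"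
    by (simp add: algebra_simps flip: exp_add)
  then show ?thesis unfolding exp_kernel_def BB_symbol_def using \<open>\<tau> \<noteq> 0\<close> p by simp
qed

lemma BB_symbol_0: "BB_symbol t 0 w = 0"
  by (simp add: BB_symbol_def)

lemma BB_symbol_holo: "BB_symbol t \<tau> holomorphic_on sector"
  unfolding BB_symbol_def by (intro holomorphic_intros)

lemma BB_symbol_measurable: "(\<lambda>\<tau>. BB_symbol t \<tau> w) \<in> borel_measurable borel"
  unfolding BB_symbol_def by measurable

lemma exp_rate_le_envelope:
  assumes "c \<le> Re (rate w)" "\<tau> \<ge> 0"
  shows "norm (exp (of_real (- \<tau>) * rate w)) \<le> envelope p c s0 (0 - \<tau>)"
  using mult_left_mono[OF assms] assms(2) by (simp add: norm_exp_eq_Re envelope_def mult.commute)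

abbreviation CB_integrand :: "(real \<Rightarrow> real ^ 'n) \<Rightarrow> real \<Rightarrow> real \<Rightarrow> complex ^ 'n" where
  "CB_integrand g t \<tau> \<equiv>
     (p / \<tau>) *\<^sub>R ((C_mat ix p ss us t ** B_tilde ix p ss us (- \<tau>)) *v pi_u ix ss us (cvec (g \<tau>)))"

abbreviation BB_integrand :: "(real \<Rightarrow> real ^ 'n) \<Rightarrow> real \<Rightarrow> real \<Rightarrow> complex ^ 'n" where
  "BB_integrand g t \<tau> \<equiv>
     (p / \<tau>) *\<^sub>R ((B_mat ix p ss us t ** B_tilde ix p ss us (- \<tau>)) *v pi_u ix ss us (cvec (g \<tau>)))"

abbreviation E_integrand :: "(real \<Rightarrow> real ^ 'n) \<Rightarrow> real \<Rightarrow> real \<Rightarrow> complex ^ 'n" where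
  "E_integrand g t \<tau> \<equiv>
     ((t - \<tau>) powr (p - 1)) *\<^sub>R
       (mittag_leffler_mat p p (((t - \<tau>) powr p) *\<^sub>R A_mat ix ss us) *v pi_u ix ss us (cvec (g \<tau>)))"

text \<open>
  The factor \<open>p / \<tau>\<close> cancels against the factor \<open>- \<tau>\<close> in the symbol of \<open>Bt(-\<tau>)\<close>, so that a bounded
  defect times a decaying exponential remains.
\<close>
lemma CB_integral_bound:
  obtains K3 where "\<And>(g :: real \<Rightarrow> real ^ 'n) t. continuous_on {0..} g \<Longrightarrow> bounded (g ` {0..}) \<Longrightarrow> t > 0 \<Longrightarrow>
    set_integrable lborel {0..} (CB_integrand g t) \<and>
    norm (LINT \<tau>:{0..}|lborel. CB_integrand g t \<tau>) \<le> K3 * sup_norm g"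
proof -
  obtain r where r: "0 < r" "r \<le> 1" "disks (2 * r) \<subseteq> sector" by (rule disks_in_sector, rule that)
  have sub: "disks r \<subseteq> sector" using r unfolding disks_def by (force simp: subset_iff)
  obtain c V where V: "c > 0" "V > 0" "\<And>w. w \<in> disks r \<Longrightarrow> c \<le> Re (rate w)"
    "\<And>w. w \<in> disks r \<Longrightarrow> norm (rate w) \<le> V" "\<And>w. w \<in> disks r \<Longrightarrow> norm (rate_deriv w) \<le> V"
    by (rule rate_bounds[OF compact_disks sub], rule that)
  obtain M where M: "M > 0" "\<And>s w. s \<ge> 0 \<Longrightarrow> w \<in> disks r \<Longrightarrow> norm (defect s w) \<le> M"
    by (rule defect_bounded[OF compact_disks sub], rule that)
  define Q where "Q = real CARD('n) ^ 2 / r ^ CARD('n)"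
  let ?\<phi> = "\<lambda>\<tau>. p * M * V * envelope p c 1 (0 - \<tau>)"
  have \<phi>: "integrable lborel ?\<phi>" "0 \<le> ?\<phi> \<tau>" for \<tau>
    using integrable_envelope_reflect(1)[OF p(1) V(1), of 1 0] p M V envelope_nonneg by auto
  show ?thesis
  proof (rule that)
    fix g :: "real \<Rightarrow> real ^ 'n" and t :: real
    assume g: "continuous_on {0..} g" "bounded (g ` {0..})" and t: "t > 0"
    let ?f = "\<lambda>\<tau> w. of_real (p / \<tau>) * (defect t w * (of_real (- \<tau>) * rate_deriv w * exp (of_real (- \<tau>) * rate w)))"
    have eq: "CB_integrand g t \<tau> = unstable_fun (?f \<tau>) *v cvec (g \<tau>)" for \<tau>
      unfolding C_B_tilde_eq by (intro scaled_projected_apply holomorphic_intros defect_holo)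
    have bound: "norm (?f \<tau> w) \<le> ?\<phi> \<tau>" if \<tau>: "\<tau> \<in> {0..}" and w: "w \<in> disks r" for \<tau> w
    proof -
      have "norm (?f \<tau> w) = (p / \<tau> * \<tau>) * norm (defect t w) * norm (rate_deriv w) * norm (exp (of_real (- \<tau>) * rate w))"
        using \<tau> p by (simp add: norm_mult norm_divide)
      also have "\<dots> \<le> p * M * V * envelope p c 1 (0 - \<tau>)"
        using \<tau> p M t w V envelope_nonneg
        by (intro mult_mono mult_nonneg_nonneg exp_rate_le_envelope) auto
      finally show ?thesis .
    qed
    have holo: "?f \<tau> holomorphic_on sector" for \<tau> by (intro holomorphic_intros defect_holo)
    have meas: "(\<lambda>\<tau>. ?f \<tau> w) \<in> borel_measurable borel" for w by measurable
    have G: "0 \<le> sup_norm g" using norm_le_sup_norm[OF g(2), of 0] norm_ge_zero order_trans by blast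
    note int = unstable_fun_apply_integrable[OF r(1,2) sub holo meas \<phi>(1) bound \<phi>(2) _ _ g, where A = "{0..}", folded Q_def]
    have "norm (LINT \<tau>:{0..}|lborel. unstable_fun (?f \<tau>) *v cvec (g \<tau>)) \<le> (Q * sup_norm g) * (LINT \<tau>|lborel. ?\<phi> \<tau>)"
      by (rule norm_set_integral_le[OF int(1) \<phi> int(2)]) (use G r in \<open>simp_all add: Q_def\<close>)
    then show "set_integrable lborel {0..} (CB_integrand g t) \<and>
    norm (LINT \<tau>:{0..}|lborel. CB_integrand g t \<tau>) \<le> (Q * (LINT \<tau>|lborel. ?\<phi> \<tau>)) * sup_norm g"
      unfolding eq using int(1) by (simp add: mult_ac)
  qed
qed

text \<open>
  Both integrals exist separately for fixed \<open>t\<close>, with bounds that may grow with \<open>t\<close>. The uniform bound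
  comes from adding the integrands first.
\<close>
lemma E_BB_integral_bound:
  obtains K5 where "\<And>(g :: real \<Rightarrow> real ^ 'n) t. continuous_on {0..} g \<Longrightarrow> bounded (g ` {0..}) \<Longrightarrow> t > 0 \<Longrightarrow>
    set_integrable lborel {0..t} (E_integrand g t) \<and>
    set_integrable lborel {0..} (BB_integrand g t) \<and>
    norm ((LINT \<tau>:{0..t}|lborel. E_integrand g t \<tau>) +
      (LINT \<tau>:{0..}|lborel. BB_integrand g t \<tau>)) \<le> K5 * sup_norm g"
proof -
  obtain r where r: "0 < r" "r \<le> 1" "disks (2 * r) \<subseteq> sector" by (rule disks_in_sector, rule that)
  have sub: "disks r \<subseteq> sector" using r unfolding disks_def by (force simp: subset_iff)
  obtain c0 V where V: "c0 > 0" "V > 0"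
    "\<And>w. w \<in> disks r \<Longrightarrow> c0 \<le> Re (rate w)" "\<And>w. w \<in> disks r \<Longrightarrow> norm (rate w) \<le> V" "\<And>w. w \<in> disks r \<Longrightarrow> norm (rate_deriv w) \<le> V"
    by (rule rate_bounds[OF compact_disks sub], rule that)
  obtain c s0 M where M: "c > 0" "s0 > 0" "M > 0"
    "\<And>s w. w \<in> disks r \<Longrightarrow> norm ((if s > 0 then ml_kernel s w else 0) - exp_kernel s w) \<le> M * envelope p c s0 s"
    by (rule ml_kernel_minus_exp_kernel_bound[OF r(1,3)], rule that)
  define Q where "Q = real CARD('n) ^ 2 / r ^ CARD('n)"
  define I where "I = (LINT s|lborel. envelope p c s0 s)"
  show ?thesis
  proof (rule that)
    fix g :: "real \<Rightarrow> real ^ 'n" and t :: real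
    assume g: "continuous_on {0..} g" "bounded (g ` {0..})" and t: "t > 0"
    have G: "0 \<le> sup_norm g" using norm_le_sup_norm[OF g(2), of 0] norm_ge_zero order_trans by blast
    have eq2: "E_integrand g t \<tau>
        = unstable_fun (ml_kernel (t - \<tau>)) *v cvec (g \<tau>)" for \<tau>
      unfolding ml_projected_apply ml_kernel_def ..
    have eq3: "BB_integrand g t \<tau>
        = unstable_fun (BB_symbol t \<tau>) *v cvec (g \<tau>)" for \<tau>
      unfolding B_B_tilde_eq BB_symbol_def by (intro scaled_projected_apply holomorphic_intros)
    obtain Mt where Mt: "Mt > 0"
      "\<And>s w. 0 \<le> s \<Longrightarrow> s \<le> t \<Longrightarrow> w \<in> disks r \<Longrightarrow> norm (mittag_leffler p 1 (of_real (s powr p) * w)) \<le> Mt"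
      "\<And>s w. 0 \<le> s \<Longrightarrow> s \<le> t \<Longrightarrow> w \<in> disks r \<Longrightarrow> norm (mittag_leffler p p (of_real (s powr p) * w)) \<le> Mt"
      by (rule ml_bounded[OF compact_disks], rule that)
    have int2: "set_integrable lborel {0..t} (\<lambda>\<tau>. unstable_fun (ml_kernel (t - \<tau>)) *v cvec (g \<tau>))"
    proof (rule unstable_fun_apply_integrable(1)[OF r(1,2) sub ml_kernel_holo ml_kernel_measurable _ _ _ _ _ g])
      show "integrable lborel (\<lambda>\<tau>. Mt * envelope p 1 t (t - \<tau>))"
        using integrable_envelope_reflect(1)[OF p(1) _ t, of 1 t] by simp
      show "norm (ml_kernel (t - \<tau>) w) \<le> Mt * envelope p 1 t (t - \<tau>)" if "\<tau> \<in> {0..t}" "w \<in> disks r" for \<tau> w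
      proof (cases "\<tau> = t")
        case True
        then show ?thesis using Mt envelope_nonneg by simp
      next
        case False
        have "norm (ml_kernel (t - \<tau>) w) \<le> (t - \<tau>) powr (p - 1) * Mt"
          unfolding ml_kernel_def norm_mult using that Mt by (intro mult_mono) auto
        then show ?thesis using that False by (simp add: envelope_def mult.commute)
      qed
      show "0 \<le> Mt * envelope p 1 t (t - \<tau>)" for \<tau> using Mt envelope_nonneg by simp
    qed auto
    have int3: "set_integrable lborel {0..} (\<lambda>\<tau>. unstable_fun (BB_symbol t \<tau>) *v cvec (g \<tau>))"
    proof (rule unstable_fun_apply_integrable(1)[OF r(1,2) sub BB_symbol_holo BB_symbol_measurable _ _ _ _ _ g])
      show "integrable lborel (\<lambda>\<tau>. V * exp (t * V) * envelope p c0 1 (0 - \<tau>))"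
        using integrable_envelope_reflect(1)[OF p(1) V(1), of 1 0] by simp
      show "norm (BB_symbol t \<tau> w) \<le> V * exp (t * V) * envelope p c0 1 (0 - \<tau>)" if "\<tau> \<in> {0..}" "w \<in> disks r" for \<tau> w
      proof (cases "\<tau> = 0")
        case True
        then show ?thesis using V envelope_nonneg by (simp add: BB_symbol_0)
      next
        case False
        have "norm (exp_kernel (t - \<tau>) w) \<le> V * exp (t * V) * norm (exp (of_real (- \<tau>) * rate w))"
          using V that t by (intro norm_exp_kernel_le(2)[where c = c0]) auto
        also have "\<dots> \<le> V * exp (t * V) * envelope p c0 1 (0 - \<tau>)"
          using V that by (intro mult_left_mono exp_rate_le_envelope) auto
        finally show ?thesis by (simp add: BB_symbol_eq[OF False])
      qed
      show "0 \<le> V * exp (t * V) * envelope p c0 1 (0 - \<tau>)" for \<tau> using V envelope_nonneg by simp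
    qed auto
    \<comment> \<open>The symbol of the sum of the two integrands, extended by zero for the first one when \<open>\<tau> > t\<close>.\<close>
    let ?h = "\<lambda>\<tau> w. (if t - \<tau> > 0 then ml_kernel (t - \<tau>) w else 0) - exp_kernel (t - \<tau>) w"
    have holo: "?h \<tau> holomorphic_on sector" for \<tau>
      by (cases "t - \<tau> > 0") (auto intro!: holomorphic_intros ml_kernel_holo exp_kernel_holo)
    have meas: "(\<lambda>\<tau>. ?h \<tau> w) \<in> borel_measurable borel" for w
      using ml_kernel_measurable exp_kernel_measurable by measurable
    have env: "integrable lborel (\<lambda>\<tau>. M * envelope p c s0 (t - \<tau>))" "0 \<le> M * envelope p c s0 (t - \<tau>)" for \<tau>
      using integrable_envelope_reflect(1)[OF p(1) M(1,2), of t] M envelope_nonneg by auto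
    have bound: "norm (?h \<tau> w) \<le> M * envelope p c s0 (t - \<tau>)" if "\<tau> \<in> {0..}" "w \<in> disks r" for \<tau> w
      by (rule M(4)[OF that(2)])
    note int = unstable_fun_apply_integrable[OF r(1,2) sub holo meas env(1) bound env(2) atLeast_borel order_refl g, folded Q_def]
    have "(LINT \<tau>:{0..t}|lborel. unstable_fun (ml_kernel (t - \<tau>)) *v cvec (g \<tau>)) +
        (LINT \<tau>:{0..}|lborel. unstable_fun (BB_symbol t \<tau>) *v cvec (g \<tau>)) =
        (LINT \<tau>|lborel. indicator {0..t} \<tau> *\<^sub>R (unstable_fun (ml_kernel (t - \<tau>)) *v cvec (g \<tau>)) +
          indicator {0..} \<tau> *\<^sub>R (unstable_fun (BB_symbol t \<tau>) *v cvec (g \<tau>)))"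
      using int2 int3 unfolding set_integrable_def set_lebesgue_integral_def
      by (rule Bochner_Integration.integral_add[symmetric])
    also have "\<dots> = (LINT \<tau>:{0..}|lborel. unstable_fun (?h \<tau>) *v cvec (g \<tau>))"
      unfolding set_lebesgue_integral_def
    proof (rule integral_cong_AE)
      \<comment> \<open>at \<open>\<tau> = 0\<close> the second symbol is \<open>0\<close>, since \<open>p / 0 = 0\<close>, and not \<open>- exp_kernel t\<close>\<close>
      show "AE \<tau> in lborel. indicator {0..t} \<tau> *\<^sub>R (unstable_fun (ml_kernel (t - \<tau>)) *v cvec (g \<tau>)) +
          indicator {0..} \<tau> *\<^sub>R (unstable_fun (BB_symbol t \<tau>) *v cvec (g \<tau>)) =
          indicator {0..} \<tau> *\<^sub>R (unstable_fun (?h \<tau>) *v cvec (g \<tau>))"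
        using AE_lborel_singleton[of "0::real"]
      proof eventually_elim
        case (elim \<tau>)
        have neg: "unstable_fun (BB_symbol t \<tau>) = - unstable_fun (exp_kernel (t - \<tau>))"
        proof -
          have "BB_symbol t \<tau> = (\<lambda>w. of_real (- 1) * exp_kernel (t - \<tau>) w)"
            by (rule ext) (simp add: BB_symbol_eq[OF elim])
          then show ?thesis
            using unstable_fun_scaleR[OF open_sector exp_kernel_holo[of "t - \<tau>"] us_in_sector, where c = "- 1"] by simp
        qed
        consider "\<tau> < 0" | "0 \<le> \<tau>" "\<tau> \<le> t" | "t < \<tau>" by linarith
        then show ?case
        proof cases
          case 1
          then show ?thesis using t by simp
        next
          case 2
          have "?h \<tau> = (\<lambda>w. ml_kernel (t - \<tau>) w - exp_kernel (t - \<tau>) w)"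
            using 2 by (cases "\<tau> = t") auto
          then have "unstable_fun (?h \<tau>) = unstable_fun (ml_kernel (t - \<tau>)) - unstable_fun (exp_kernel (t - \<tau>))"
            using unstable_fun_diff[OF open_sector ml_kernel_holo[of "t - \<tau>"] exp_kernel_holo[of "t - \<tau>"] us_in_sector] by simp
          then show ?thesis using 2 by (simp add: neg matrix_vector_mult_add_rdistrib[symmetric] flip: diff_conv_add_uminus)
        next
          case 3
          have "?h \<tau> = BB_symbol t \<tau>" using 3 by (intro ext) (simp add: BB_symbol_eq[OF elim])
          then show ?thesis using 3 t by simp
        qed
      qed
    qed (use int2 int3 int(1) in \<open>auto simp: set_integrable_def\<close>)
    finally have sum: "(LINT \<tau>:{0..t}|lborel. unstable_fun (ml_kernel (t - \<tau>)) *v cvec (g \<tau>)) +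
        (LINT \<tau>:{0..}|lborel. unstable_fun (BB_symbol t \<tau>) *v cvec (g \<tau>)) =
        (LINT \<tau>:{0..}|lborel. unstable_fun (?h \<tau>) *v cvec (g \<tau>))" .
    have "norm (LINT \<tau>:{0..}|lborel. unstable_fun (?h \<tau>) *v cvec (g \<tau>)) \<le> (Q * sup_norm g) * (LINT \<tau>|lborel. M * envelope p c s0 (t - \<tau>))"
      by (rule norm_set_integral_le[OF int(1) env int(2)]) (use G r in \<open>simp_all add: Q_def\<close>)
    also have "(LINT \<tau>|lborel. M * envelope p c s0 (t - \<tau>)) = M * I"
      unfolding I_def using integrable_envelope_reflect(2)[OF p(1) M(1,2), of t] by simp
    finally show "set_integrable lborel {0..t} (E_integrand g t) \<and>
    set_integrable lborel {0..} (BB_integrand g t) \<and>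
    norm ((LINT \<tau>:{0..t}|lborel. E_integrand g t \<tau>) +
      (LINT \<tau>:{0..}|lborel. BB_integrand g t \<tau>)) \<le> (Q * (M * I)) * sup_norm g"
      unfolding eq2 eq3 sum using int2 int3 by (simp add: mult_ac)
  qed
qed

end

theorem lemma8:
  fixes p N :: real
    and ix :: "'n::finite \<Rightarrow> nat"
    and ss us :: "(nat \<times> complex) list"
  assumes p: "0 < p" "p < 1"
    and ix: "bij_betw ix UNIV {..<CARD('n)}"
    and dim: "sum_list (map fst (ss @ us)) = CARD('n)"
    and size: "\<And>n z. (n, z) \<in> set (ss @ us) \<Longrightarrow> n \<ge> 1"
    and nonzero: "\<And>n z. (n, z) \<in> set (ss @ us) \<Longrightarrow> z \<noteq> 0"
    and stable: "\<And>n z. (n, z) \<in> set ss \<Longrightarrow> \<bar>Arg z\<bar> > p * pi / 2"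
    and unstable: "\<And>n z. (n, z) \<in> set us \<Longrightarrow> \<bar>Arg z\<bar> < p * pi / 2"
    and N: "N > 0"
  shows "\<exists>K3 K5. \<forall>(g :: real \<Rightarrow> real ^ 'n) t.
    continuous_on {0..} g \<longrightarrow> bounded (g ` {0..}) \<longrightarrow> t > N \<longrightarrow>
    (let A = A_mat ix ss us;
         B = B_mat ix p ss us;
         Bt = B_tilde ix p ss us;
         C = C_mat ix p ss us;
         gu = (\<lambda>\<tau>. pi_u ix ss us (cvec (g \<tau>)));
         F1 = (\<lambda>\<tau>. (p / \<tau>) *\<^sub>R ((C t ** Bt (- \<tau>)) *v gu \<tau>));
         F2 = (\<lambda>\<tau>. ((t - \<tau>) powr (p - 1)) *\<^sub>R
                     (mittag_leffler_mat p p (((t - \<tau>) powr p) *\<^sub>R A) *v gu \<tau>));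
         F3 = (\<lambda>\<tau>. (p / \<tau>) *\<^sub>R ((B t ** Bt (- \<tau>)) *v gu \<tau>))
     in (set_integrable lborel {0..} F1 \<and>
         norm (LINT \<tau>:{0..}|lborel. F1 \<tau>) \<le> K3 * sup_norm g) \<and>
        (set_integrable lborel {0..t} F2 \<and> set_integrable lborel {0..} F3 \<and>
         norm ((LINT \<tau>:{0..t}|lborel. F2 \<tau>) + (LINT \<tau>:{0..}|lborel. F3 \<tau>)) \<le> K5 * sup_norm g))"
proof -
  interpret unstable_spectrum ix ss us p
  proof unfold_locales
    show "z \<noteq> 0" if "(n, z) \<in> set us" for n z using nonzero[of n z] that by simp
    show "\<bar>Arg z\<bar> < p * pi / 2" if "(n, z) \<in> set us" for n z using unstable[OF that] .
  qed (rule ix dim p)+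
  obtain K3 where K3: "\<And>(g :: real \<Rightarrow> real ^ 'n) t. continuous_on {0..} g \<Longrightarrow> bounded (g ` {0..}) \<Longrightarrow> t > 0 \<Longrightarrow>
    set_integrable lborel {0..} (CB_integrand g t) \<and>
    norm (LINT \<tau>:{0..}|lborel. CB_integrand g t \<tau>) \<le> K3 * sup_norm g"
    by (rule CB_integral_bound, rule that)
  obtain K5 where K5: "\<And>(g :: real \<Rightarrow> real ^ 'n) t. continuous_on {0..} g \<Longrightarrow> bounded (g ` {0..}) \<Longrightarrow> t > 0 \<Longrightarrow>
    set_integrable lborel {0..t} (E_integrand g t) \<and>
    set_integrable lborel {0..} (BB_integrand g t) \<and>
    norm ((LINT \<tau>:{0..t}|lborel. E_integrand g t \<tau>) +
      (LINT \<tau>:{0..}|lborel. BB_integrand g t \<tau>)) \<le> K5 * sup_norm g"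
    by (rule E_BB_integral_bound, rule that)
  show ?thesis
    unfolding Let_def
  proof (rule exI[of _ K3], rule exI[of _ K5], intro allI impI)
    fix g :: "real \<Rightarrow> real ^ 'n" and t :: real
    assume g: "continuous_on {0..} g" "bounded (g ` {0..})" and "t > N"
    from \<open>t > N\<close> N have t: "t > 0" by linarith
    show "(set_integrable lborel {0..} (CB_integrand g t) \<and>
    norm (LINT \<tau>:{0..}|lborel. CB_integrand g t \<tau>) \<le> K3 * sup_norm g) \<and>
    set_integrable lborel {0..t} (E_integrand g t) \<and>
    set_integrable lborel {0..} (BB_integrand g t) \<and>
    norm ((LINT \<tau>:{0..t}|lborel. E_integrand g t \<tau>) +
      (LINT \<tau>:{0..}|lborel. BB_integrand g t \<tau>)) \<le> K5 * sup_norm g"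
      by (rule conjI[OF K3[OF g t] K5[OF g t]])
  qed
qed

end
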